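(* Let $1\le p'\le\infty$ and $u\in\mathcal G_{L^{p'}}(\Omega,\mathbb R^d)$. Then $\mathrm E(u^p)$ is a well-defined element of $\mathcal G(\mathbb R^d)$ for every integer $p$ with $1\le p\le p'$ (every integer $p\geq 1$ if $p'=\infty$). That is, for every representative $(u_\varepsilon)_{\varepsilon\in(0,1]}$ of $u$ the functions $x\mapsto\mathrm E(u_\varepsilon(x,\cdot)^p)$ are smooth and form a family in $\mathcal E_M(\mathbb R^d)$, whose class in $\mathcal G(\mathbb R^d)$ does not depend on the choice of the representative.
   Context: $(\Omega,\Sigma,P)$ is a probability space (assumed complete whenever needed), $\mathrm E$ denotes expectation. A random field on $\mathbb R^d$ is a map $\mathbb R^d\times\Omega\to\mathbb R$, $(x,\omega)\mapsto A(x,\omega)$, such that $\omega\mapsto A(x,\omega)$ is measurable for every $x$. A family $(r_\varepsilon)_{\varepsilon\in(0,1]}$ of numbers is moderate if $\exists a\ge 0:\ |r_\varepsilon|=O(\varepsilon^{-a})$ as $\varepsilon\to0$, and negligible if $\forall b\ge0:\ |r_\varepsilon|=O(\varepsilon^{b})$ as $\varepsilon\to 0$. $\mathcal E_M(\mathbb R^d)$ (respectively $\mathcal N(\mathbb R^d)$) is the set of families $(u_\varepsilon)_{\varepsilon\in(0,1]}$ of functions in $\mathcal C^\infty(\mathbb R^d)$ such that for all compact $K\subset\mathbb R^d$ and all $\alpha\in\mathbb N_0^d$ the family $(\sup_{x\in K}|\partial^\alpha u_\varepsilon(x)|)_{\varepsilon}$ is moderate (respectively negligible). $\mathcal G(\mathbb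 R^d)=\mathcal E_M(\mathbb R^d)/\mathcal N(\mathbb R^d)$. For $1\le q\le\infty$, $\mathcal E_{M,L^q}(\Omega,\mathbb R^d)$ (respectively $\mathcal N_{L^q}(\Omega,\mathbb R^d)$) is the set of families $(u_\varepsilon)_{\varepsilon\in(0,1]}$ of random fields on $\mathbb R^d$ such that: for almost all $\omega$ and all $\varepsilon\in(0,1]$, $x\mapsto u_\varepsilon(x,\omega)$ is in $\mathcal C^\infty(\mathbb R^d)$; for all $x,\varepsilon$, $\omega\mapsto u_\varepsilon(x,\omega)$ is measurable; for all $x\in\mathbb R^d$, $\alpha\in\mathbb N_0^d$, $\varepsilon\in(0,1]$, $\omega\mapsto\partial^\alpha u_\varepsilon(x,\omega)$ belongs to $L^q(\Omega)$ and for all compact $K\subset\mathbb R^d$, $\sup_{x\in K}\|\partial^\alpha u_\varepsilon(x)\|_{L^q(\Omega)}$ is finite; and for all compact $K$ and all $\alpha$, the family $(\sup_{x\in K}\|\partial^\alpha u_\varepsilon(x)\|_{L^q(\Omega)})_{\varepsilon}$ is moderate (respectively negligible). $\mathcal G_{L^q}(\Omega,\mathbb R^d)=\mathcal E_{M,L^q}(\Omega,\mathbb R^d)/\mathcal N_{L^q}(\Omega,\mathbb R^d)$. *)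

theory Defs
  imports "HOL-Probability.Probability" "HOL-Library.Landau_Symbols"
begin

section \<open>Smooth functions and partial derivatives\<close>

text \<open>The coordinates of \<open>real ^ 'd\<close> are indexed by a finite linearly ordered type, so that
  \<open>'d\<close> plays the role of the index set 1, ..., d.\<close>

definition partial_deriv :: "'d::finite \<Rightarrow> (real ^ 'd \<Rightarrow> real) \<Rightarrow> real ^ 'd \<Rightarrow> real" where
  "partial_deriv i f = (\<lambda>x. deriv (\<lambda>t. f (x + t *\<^sub>R axis i 1)) 0)"

definition has_partials :: "(real ^ 'd::finite \<Rightarrow> real) \<Rightarrow> bool" where
  "has_partials f \<longleftrightarrow> (\<forall>i x. (\<lambda>t. f (x + t *\<^sub>R axis i 1)) differentiable (at 0))"

text \<open>All iterated partial derivatives, taken in any order, exist and are continuous.\<close>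

definition smooth :: "(real ^ 'd::finite \<Rightarrow> real) \<Rightarrow> bool" where
  "smooth f \<longleftrightarrow> (\<forall>is. let g = foldr partial_deriv is f in has_partials g \<and> continuous_on UNIV g)"

text \<open>The derivative of multi-index \<open>\<alpha>\<close>: the powers of the coordinate derivatives are
  composed in the order of \<open>'d\<close>, which is irrelevant for smooth functions.\<close>

definition multi_deriv ::
    "('d::{finite,linorder} \<Rightarrow> nat) \<Rightarrow>
     (real ^ 'd::{finite,linorder} \<Rightarrow> real) \<Rightarrow> real ^ 'd::{finite,linorder} \<Rightarrow> real" where
  "multi_deriv \<alpha> f = foldr (\<lambda>i. partial_deriv i ^^ \<alpha> i) (sorted_list_of_set UNIV) f"


section \<open>Moderate and negligible families\<close>

text \<open>Families indexed by (0,1] are represented by functions on all reals; values of the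
  parameter outside (0,1] are never inspected.\<close>

definition moderate :: "(real \<Rightarrow> real) \<Rightarrow> bool" where
  "moderate r \<longleftrightarrow> (\<exists>a\<ge>0. r \<in> O[at_right 0](\<lambda>\<epsilon>. \<epsilon> powr (- a)))"

definition negligible_family :: "(real \<Rightarrow> real) \<Rightarrow> bool" where
  "negligible_family r \<longleftrightarrow> (\<forall>b\<ge>0. r \<in> O[at_right 0](\<lambda>\<epsilon>. \<epsilon> powr b))"


section \<open>The Colombeau algebra\<close>

text \<open>The growth condition is a parameter. Compact sets are taken nonempty because the
  supremum of the empty set of reals is unspecified; the empty set imposes no condition.\<close>

definition smooth_families ::
    "((real \<Rightarrow> real) \<Rightarrow> bool) \<Rightarrow> (real \<Rightarrow> real ^ 'd::{finite,linorder} \<Rightarrow> real) set" where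
  "smooth_families growth = {u.
     (\<forall>\<epsilon>\<in>{0<..1}. smooth (u \<epsilon>)) \<and>
     (\<forall>K \<alpha>. compact K \<and> K \<noteq> {} \<longrightarrow> growth (\<lambda>\<epsilon>. SUP x\<in>K. \<bar>multi_deriv \<alpha> (u \<epsilon>) x\<bar>))}"

definition E_M :: "(real \<Rightarrow> real ^ 'd::{finite,linorder} \<Rightarrow> real) set" where
  "E_M = smooth_families moderate"

definition N_M :: "(real \<Rightarrow> real ^ 'd::{finite,linorder} \<Rightarrow> real) set" where
  "N_M = smooth_families negligible_family"

definition colombeau_rel ::
    "((real \<Rightarrow> real ^ 'd::{finite,linorder} \<Rightarrow> real) \<times>
      (real \<Rightarrow> real ^ 'd::{finite,linorder} \<Rightarrow> real)) set" where
  "colombeau_rel = {(u, v). u \<in> E_M \<and> v \<in> E_M \<and> (\<lambda>\<epsilon> x. u \<epsilon> x - v \<epsilon> x) \<in> N_M}"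

definition colombeau_algebra :: "(real \<Rightarrow> real ^ 'd::{finite,linorder} \<Rightarrow> real) set set" where
  "colombeau_algebra = E_M // colombeau_rel"


section \<open>Random generalized functions\<close>

definition in_Lq :: "'w measure \<Rightarrow> ereal \<Rightarrow> ('w \<Rightarrow> real) \<Rightarrow> bool" where
  "in_Lq M q f \<longleftrightarrow> f \<in> borel_measurable M \<and>
     (if q = \<infinity> then esssup M (\<lambda>\<omega>. ereal \<bar>f \<omega>\<bar>) < \<infinity>
      else integrable M (\<lambda>\<omega>. \<bar>f \<omega>\<bar> powr real_of_ereal q))"

definition Lq_norm :: "'w measure \<Rightarrow> ereal \<Rightarrow> ('w \<Rightarrow> real) \<Rightarrow> real" where
  "Lq_norm M q f =
     (if q = \<infinity> then real_of_ereal (esssup M (\<lambda>\<omega>. ereal \<bar>f \<omega>\<bar>))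
      else (\<integral>\<omega>. \<bar>f \<omega>\<bar> powr real_of_ereal q \<partial>M) powr (1 / real_of_ereal q))"

text \<open>A path of a random field is smooth only outside a null set, so its derivatives at a point
  are random variables defined only almost everywhere. Membership in \<open>L\<^sup>q\<close> and the norm are
  therefore taken with respect to the completion of \<open>M\<close>, which makes them independent of the
  values on the exceptional null set. If \<open>M\<close> is complete, this is the space \<open>L\<^sup>q\<close> of \<open>M\<close>
  itself.\<close>

definition Lq_families ::
    "'w measure \<Rightarrow> ereal \<Rightarrow> ((real \<Rightarrow> real) \<Rightarrow> bool) \<Rightarrow>
     (real \<Rightarrow> real ^ 'd::{finite,linorder} \<Rightarrow> 'w \<Rightarrow> real) set" where
  "Lq_families M q growth = {u.
     (AE \<omega> in M. \<forall>\<epsilon>\<in>{0<..1}. smooth (\<lambda>x. u \<epsilon> x \<omega>)) \<and>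
     (\<forall>\<epsilon>\<in>{0<..1}. \<forall>x. u \<epsilon> x \<in> borel_measurable M) \<and>
     (\<forall>\<epsilon>\<in>{0<..1}. \<forall>\<alpha>.
        (\<forall>x. in_Lq (completion M) q (\<lambda>\<omega>. multi_deriv \<alpha> (\<lambda>y. u \<epsilon> y \<omega>) x)) \<and>
        (\<forall>K. compact K \<longrightarrow>
          bdd_above ((\<lambda>x. Lq_norm (completion M) q (\<lambda>\<omega>. multi_deriv \<alpha> (\<lambda>y. u \<epsilon> y \<omega>) x)) ` K))) \<and>
     (\<forall>K \<alpha>. compact K \<and> K \<noteq> {} \<longrightarrow>
        growth (\<lambda>\<epsilon>. SUP x\<in>K.
          Lq_norm (completion M) q (\<lambda>\<omega>. multi_deriv \<alpha> (\<lambda>y. u \<epsilon> y \<omega>) x)))}"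

definition E_M_Lq ::
    "'w measure \<Rightarrow> ereal \<Rightarrow> (real \<Rightarrow> real ^ 'd::{finite,linorder} \<Rightarrow> 'w \<Rightarrow> real) set" where
  "E_M_Lq M q = Lq_families M q moderate"

definition N_Lq ::
    "'w measure \<Rightarrow> ereal \<Rightarrow> (real \<Rightarrow> real ^ 'd::{finite,linorder} \<Rightarrow> 'w \<Rightarrow> real) set" where
  "N_Lq M q = Lq_families M q negligible_family"

definition colombeau_rel_Lq ::
    "'w measure \<Rightarrow> ereal \<Rightarrow>
     ((real \<Rightarrow> real ^ 'd::{finite,linorder} \<Rightarrow> 'w \<Rightarrow> real) \<times>
      (real \<Rightarrow> real ^ 'd::{finite,linorder} \<Rightarrow> 'w \<Rightarrow> real)) set" where
  "colombeau_rel_Lq M q =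
     {(u, v). u \<in> E_M_Lq M q \<and> v \<in> E_M_Lq M q \<and> (\<lambda>\<epsilon> x \<omega>. u \<epsilon> x \<omega> - v \<epsilon> x \<omega>) \<in> N_Lq M q}"

definition colombeau_algebra_Lq ::
    "'w measure \<Rightarrow> ereal \<Rightarrow> (real \<Rightarrow> real ^ 'd::{finite,linorder} \<Rightarrow> 'w \<Rightarrow> real) set set" where
  "colombeau_algebra_Lq M q = E_M_Lq M q // colombeau_rel_Lq M q"

definition moment_family ::
    "'w measure \<Rightarrow> nat \<Rightarrow> (real \<Rightarrow> real ^ 'd::finite \<Rightarrow> 'w \<Rightarrow> real) \<Rightarrow> real \<Rightarrow> real ^ 'd \<Rightarrow> real" where
  "moment_family M p u = (\<lambda>\<epsilon> x. \<integral>\<omega>. u \<epsilon> x \<omega> ^ p \<partial>M)"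

end

theory Submission
  imports Defs
begin

text \<open>Pathwise smoothness and local \<open>L\<^sup>q\<close> bounds on all derivatives allow differentiation under the
  expectation: a random field whose first and second derivatives are locally bounded in \<open>L\<^sup>1\<close> has
  an expectation with partial derivatives, and locally bounded partial derivatives of all orders
  already force smoothness. Derivatives of a product of \<open>p\<close> factors are sums of products of \<open>p\<close>
  factors, so Hoelder's inequality with \<open>p \<le> q\<close> bounds all derivatives of the moment. For two
  representatives, \<open>u\<^sup>p - v\<^sup>p\<close> telescopes into products each containing the negligible factor \<open>u - v\<close>.\<close>

section \<open>Iterated partial derivatives\<close>

text \<open>The bounds control the supremum over \<open>x\<close> of an expectation, not the
  expectation of a supremum, so no integrable majorant for the difference quotients is at hand and
  dominated convergence does not apply. The substitute is a Taylor expansion in the mean: a local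
  L^1 bound on the second derivative makes the remainder of order h^2 in L^1. Each step thus
  consumes higher derivatives, which is harmless since all orders are controlled.

  Two mismatches shape the rest. Bounds are given for multi-indices, in one fixed order of
  differentiation, while \<open>smooth\<close> speaks of arbitrary lists of directions; the symmetry
  of mixed derivatives bridges this. Derivatives of paths are random variables only up to null sets,
  so the estimates live on the completion of \<open>M\<close>, and only the final expectation, that
  of a power of the measurable \<open>u \<epsilon> x\<close>, returns to \<open>M\<close>.

  Products of \<open>p\<close> possibly different fields replace powers because they are stable
  under the product rule. Moderate and negligible growth are handled by one argument, as an algebra
  and an ideal in it.\<close>

lemma partial_derivI:
  assumes "((\<lambda>t. f (x + t *\<^sub>R axis i 1)) has_real_derivative D) (at 0)"
  shows "partial_deriv i f x = D"
  using assms by (simp add: partial_deriv_def DERIV_imp_deriv)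

text \<open>\<open>has_partials\<close> only speaks of the parameter 0. As the base point is
  arbitrary, shifting it along the line gives every parameter \<open>s\<close>, the form that mean
  value arguments require.\<close>

lemma has_partials_DERIV:
  assumes "has_partials f"
  shows "((\<lambda>t. f (x + t *\<^sub>R axis i 1)) has_real_derivative
            partial_deriv i f (x + s *\<^sub>R axis i 1)) (at s)"
proof -
  let ?g = "\<lambda>t. f ((x + s *\<^sub>R axis i 1) + t *\<^sub>R axis i 1)"
  have "?g differentiable (at 0)"
    using assms unfolding has_partials_def by blast
  then have "(?g has_real_derivative partial_deriv i f (x + s *\<^sub>R axis i 1)) (at 0)"
    by (simp add: partial_deriv_def DERIV_deriv_iff_real_differentiable)
  moreover have "?g = (\<lambda>t. f (x + (t + s) *\<^sub>R axis i 1))"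
    by (simp add: algebra_simps)
  ultimately show ?thesis
    using DERIV_at_within_shift[of "\<lambda>t. f (x + t *\<^sub>R axis i 1)" "partial_deriv i f (x + s *\<^sub>R axis i 1)" s 0 UNIV]
    by (simp add: add.commute)
qed

lemma smooth_has_partials: "smooth f \<Longrightarrow> has_partials (foldr partial_deriv is f)"
  and smooth_continuous: "smooth f \<Longrightarrow> continuous_on UNIV (foldr partial_deriv is f)"
  by (simp_all add: smooth_def Let_def)

lemma smooth_foldr: "smooth f \<Longrightarrow> smooth (foldr partial_deriv is f)"
  unfolding smooth_def Let_def by (metis foldr_append o_apply)

text \<open>The mean value theorem is applied in direction \<open>i\<close> to the difference of
  \<open>f\<close> along two parallel lines, then in direction \<open>j\<close> to
  \<open>partial_deriv i f\<close>. The second difference is symmetric in \<open>i\<close> and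
  \<open>j\<close>, whereas the right-hand side singles out one order of differentiation.\<close>

lemma second_difference_MVT:
  assumes "has_partials f" "has_partials (partial_deriv i f)" "0 < h"
  obtains s t where "0 < s" "s < h" "0 < t" "t < h"
    "f (x + h *\<^sub>R axis i 1 + h *\<^sub>R axis j 1) - f (x + h *\<^sub>R axis i 1)
       - f (x + h *\<^sub>R axis j 1) + f x
     = h\<^sup>2 * partial_deriv j (partial_deriv i f) (x + s *\<^sub>R axis i 1 + t *\<^sub>R axis j 1)"
proof -
  let ?e = "axis i 1" and ?e' = "axis j 1"
  have "\<exists>s. 0 < s \<and> s < h \<and>
      (f ((x + h *\<^sub>R ?e') + h *\<^sub>R ?e) - f (x + h *\<^sub>R ?e))
      - (f ((x + h *\<^sub>R ?e') + 0 *\<^sub>R ?e) - f (x + 0 *\<^sub>R ?e))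
      = (h - 0) * (partial_deriv i f ((x + h *\<^sub>R ?e') + s *\<^sub>R ?e) - partial_deriv i f (x + s *\<^sub>R ?e))"
    using assms(3) by (intro MVT2 DERIV_diff has_partials_DERIV assms(1)) auto
  then obtain s where s: "0 < s" "s < h"
      "(f ((x + h *\<^sub>R ?e') + h *\<^sub>R ?e) - f (x + h *\<^sub>R ?e)) - (f (x + h *\<^sub>R ?e') - f x)
      = h * (partial_deriv i f ((x + h *\<^sub>R ?e') + s *\<^sub>R ?e) - partial_deriv i f (x + s *\<^sub>R ?e))"
    by auto
  have "\<exists>t. 0 < t \<and> t < h \<and>
      partial_deriv i f ((x + s *\<^sub>R ?e) + h *\<^sub>R ?e') - partial_deriv i f ((x + s *\<^sub>R ?e) + 0 *\<^sub>R ?e')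
      = (h - 0) * partial_deriv j (partial_deriv i f) ((x + s *\<^sub>R ?e) + t *\<^sub>R ?e')"
    using assms(3) by (intro MVT2 has_partials_DERIV assms(2)) auto
  then obtain t where t: "0 < t" "t < h"
      "partial_deriv i f ((x + s *\<^sub>R ?e) + h *\<^sub>R ?e') - partial_deriv i f (x + s *\<^sub>R ?e)
      = h * partial_deriv j (partial_deriv i f) ((x + s *\<^sub>R ?e) + t *\<^sub>R ?e')"
    by auto
  show thesis
    using that[OF s(1,2) t(1,2)] s(3) t(3) by (simp add: algebra_simps power2_eq_square)
qed

lemma second_difference_limit:
  assumes "has_partials f" "has_partials (partial_deriv i f)"
    and cont: "continuous_on UNIV (partial_deriv j (partial_deriv i f))"
  shows "(\<lambda>n. (f (x + (1 / Suc n) *\<^sub>R axis i 1 + (1 / Suc n) *\<^sub>R axis j 1) - f (x + (1 / Suc n) *\<^sub>R axis i 1)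
       - f (x + (1 / Suc n) *\<^sub>R axis j 1) + f x) / (1 / real (Suc n))\<^sup>2)
     \<longlonglongrightarrow> partial_deriv j (partial_deriv i f) x" (is "?Q \<longlonglongrightarrow> ?d x")
proof -
  have "\<exists>s t. 0 < s \<and> s < 1 / Suc n \<and> 0 < t \<and> t < 1 / Suc n \<and>
      ?Q n = ?d (x + s *\<^sub>R axis i 1 + t *\<^sub>R axis j 1)" for n
  proof -
    from second_difference_MVT[OF assms(1,2), of "1 / Suc n" x j]
    obtain s t where "0 < s" "s < 1 / Suc n" "0 < t" "t < 1 / Suc n"
      "f (x + (1 / Suc n) *\<^sub>R axis i 1 + (1 / Suc n) *\<^sub>R axis j 1) - f (x + (1 / Suc n) *\<^sub>R axis i 1)
       - f (x + (1 / Suc n) *\<^sub>R axis j 1) + f x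
       = (1 / Suc n)\<^sup>2 * ?d (x + s *\<^sub>R axis i 1 + t *\<^sub>R axis j 1)"
      by (metis divide_pos_pos of_nat_0_less_iff zero_less_Suc zero_less_one)
    then show ?thesis
      by (intro exI[of _ s] exI[of _ t]) (auto simp del: of_nat_Suc)
  qed
  then obtain s t where st: "\<And>n. 0 < s n" "\<And>n. s n < 1 / Suc n" "\<And>n. 0 < t n" "\<And>n. t n < 1 / Suc n"
      and Q: "\<And>n. ?Q n = ?d (x + s n *\<^sub>R axis i 1 + t n *\<^sub>R axis j 1)"
    by metis
  have lim: "(\<lambda>n. 1 / real (Suc n)) \<longlonglongrightarrow> 0"
    using LIMSEQ_inverse_real_of_nat by (simp add: inverse_eq_divide)
  have "s \<longlonglongrightarrow> 0" "t \<longlonglongrightarrow> 0"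
    by (rule real_tendsto_sandwich[OF _ _ tendsto_const lim]; intro always_eventually allI less_imp_le st)+
  then have "(\<lambda>n. x + s n *\<^sub>R axis i 1 + t n *\<^sub>R axis j 1) \<longlonglongrightarrow> x + 0 *\<^sub>R axis i 1 + 0 *\<^sub>R axis j 1"
    by (intro tendsto_intros)
  moreover have "isCont ?d x"
    using cont by (simp add: continuous_on_eq_continuous_at)
  ultimately have "(\<lambda>n. ?d (x + s n *\<^sub>R axis i 1 + t n *\<^sub>R axis j 1)) \<longlonglongrightarrow> ?d x"
    using isCont_tendsto_compose by fastforce
  then show ?thesis
    by (simp only: Q)
qed

text \<open>Schwarz's theorem: exchanging \<open>i\<close> and \<open>j\<close> leaves the second
  difference quotient unchanged, so one and the same sequence has both mixed derivatives as its
  limit.\<close>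

lemma smooth_partial_deriv_commute:
  assumes "smooth f"
  shows "partial_deriv i (partial_deriv j f) = partial_deriv j (partial_deriv i f)"
proof
  fix x
  note p = smooth_has_partials[OF assms, of "[]", simplified]
    smooth_has_partials[OF assms, of "[_]", simplified] smooth_continuous[OF assms, of "[_,_]", simplified]
  let ?Q = "\<lambda>i j n. (f (x + (1 / Suc n) *\<^sub>R axis i 1 + (1 / Suc n) *\<^sub>R axis j 1) - f (x + (1 / Suc n) *\<^sub>R axis i 1)
       - f (x + (1 / Suc n) *\<^sub>R axis j 1) + f x) / (1 / real (Suc n))\<^sup>2"
  have eq: "?Q j i = ?Q i j"
    by (intro ext arg_cong2[where f = "(/)"] refl) (simp add: algebra_simps)
  have "?Q j i \<longlonglongrightarrow> partial_deriv i (partial_deriv j f) x"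
    by (rule second_difference_limit[OF p])
  then have "?Q i j \<longlonglongrightarrow> partial_deriv i (partial_deriv j f) x"
    unfolding eq .
  moreover have "?Q i j \<longlonglongrightarrow> partial_deriv j (partial_deriv i f) x"
    by (rule second_difference_limit[OF p])
  ultimately show "partial_deriv i (partial_deriv j f) x = partial_deriv j (partial_deriv i f) x"
    by (rule LIMSEQ_unique)
qed

lemma foldr_partial_deriv_move:
  assumes "smooth f"
  shows "foldr partial_deriv (is @ i # js) f = foldr partial_deriv (i # is @ js) f"
proof (induction "is")
  case (Cons k "is")
  have "smooth (foldr partial_deriv (is @ js) f)"
    by (rule smooth_foldr[OF assms])
  from smooth_partial_deriv_commute[OF this, of i k] show ?case
    using Cons by simp
qed simp

text \<open>The head of one list is located in the other and moved to the front by commuting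
  derivatives, which reduces the claim to the tails.\<close>

lemma foldr_partial_deriv_perm:
  assumes "smooth f" "mset is = mset js"
  shows "foldr partial_deriv is f = foldr partial_deriv js f"
  using assms(2)
proof (induction "is" arbitrary: js)
  case (Cons i "is")
  then have "i \<in> set js"
    by (metis list.set_intros(1) mset_eq_setD)
  then obtain as bs where js: "js = as @ i # bs"
    by (meson split_list)
  have "foldr partial_deriv is f = foldr partial_deriv (as @ bs) f"
    using Cons.prems by (intro Cons.IH) (simp add: js)
  then show ?case
    using foldr_partial_deriv_move[OF assms(1), of as i bs] by (simp add: js)
qed simp

lemma multi_deriv_eq_foldr:
  "multi_deriv \<alpha> f =
     foldr partial_deriv (concat (map (\<lambda>i. replicate (\<alpha> i) i) (sorted_list_of_set UNIV))) f"
proof -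
  have "foldr partial_deriv (replicate n i) f = (partial_deriv i ^^ n) f" for n i and f :: "real ^ 'a::{finite,linorder} \<Rightarrow> real"
    by (induction n) auto
  then have "foldr (\<lambda>i. partial_deriv i ^^ \<alpha> i) xs f
    = foldr partial_deriv (concat (map (\<lambda>i. replicate (\<alpha> i) i) xs)) f" for xs
    by (induction xs) (auto simp: foldr_append)
  then show ?thesis
    by (simp add: multi_deriv_def)
qed

text \<open>This carries estimates for multi-indices over to differentiation in any order: the list
  that spells out the multi-index has the same multiplicities as \<open>is\<close>.\<close>

lemma foldr_eq_multi_deriv:
  assumes "smooth f"
  shows "foldr partial_deriv is f = multi_deriv (count (mset is)) f"
proof -
  have eq: "mset (concat (map (\<lambda>i. replicate (\<alpha> i) i) xs)) = (\<Sum>i\<in>set xs. replicate_mset (\<alpha> i) i)"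
    if "distinct xs" for xs and \<alpha> :: "'a \<Rightarrow> nat"
    using that by (induction xs) auto
  have "mset is = (\<Sum>i\<in>UNIV. replicate_mset (count (mset is) i) i)"
    by (rule multiset_eqI) (simp add: count_sum)
  then have "mset is = mset (concat (map (\<lambda>i. replicate (count (mset is) i) i) (sorted_list_of_set UNIV)))"
    by (subst eq) simp_all
  then show ?thesis
    unfolding multi_deriv_eq_foldr by (rule foldr_partial_deriv_perm[OF assms])
qed

lemma foldr_partial_deriv_linear:
  assumes "smooth f" "smooth g"
  shows "foldr partial_deriv is (\<lambda>x. a * f x + b * g x)
    = (\<lambda>x. a * foldr partial_deriv is f x + b * foldr partial_deriv is g x)"
proof (induction "is")
  case (Cons i "is")
  have "partial_deriv i (\<lambda>x. a * foldr partial_deriv is f x + b * foldr partial_deriv is g x) x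
    = a * partial_deriv i (foldr partial_deriv is f) x + b * partial_deriv i (foldr partial_deriv is g) x" for x
    using has_partials_DERIV[OF smooth_has_partials[OF assms(1), of "is"], of x i 0]
      has_partials_DERIV[OF smooth_has_partials[OF assms(2), of "is"], of x i 0]
    by (intro partial_derivI) (auto intro!: derivative_eq_intros)
  then show ?case
    by (simp add: Cons.IH)
qed simp

lemma smooth_linear:
  assumes "smooth f" "smooth g"
  shows "smooth (\<lambda>x. a * f x + b * g x)"
  unfolding smooth_def Let_def
proof (intro allI conjI)
  fix "is"
  note fg = has_partials_DERIV[OF smooth_has_partials[OF assms(1), of "is"]]
      has_partials_DERIV[OF smooth_has_partials[OF assms(2), of "is"]]
  show "has_partials (foldr partial_deriv is (\<lambda>x. a * f x + b * g x))"
    unfolding foldr_partial_deriv_linear[OF assms] has_partials_def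
    using DERIV_add[OF DERIV_cmult[OF fg(1)] DERIV_cmult[OF fg(2)]]
    unfolding real_differentiable_def by blast
  show "continuous_on UNIV (foldr partial_deriv is (\<lambda>x. a * f x + b * g x))"
    unfolding foldr_partial_deriv_linear[OF assms]
    by (intro continuous_intros smooth_continuous assms)
qed

lemma foldr_partial_deriv_0: "foldr partial_deriv is (\<lambda>x. 0) = (\<lambda>x. 0)"
  by (induction "is") (auto simp: partial_deriv_def)

lemma smooth_0: "smooth (\<lambda>x. 0)"
  by (auto simp: smooth_def foldr_partial_deriv_0 has_partials_def)

lemma multi_deriv_linear:
  assumes "smooth f" "smooth g"
  shows "multi_deriv \<alpha> (\<lambda>x. a * f x + b * g x) = (\<lambda>x. a * multi_deriv \<alpha> f x + b * multi_deriv \<alpha> g x)"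
  using foldr_partial_deriv_linear[OF assms] by (simp add: multi_deriv_eq_foldr)

lemma multi_deriv_0: "multi_deriv \<alpha> (\<lambda>x. 0) = (\<lambda>x. 0)"
  by (simp add: multi_deriv_eq_foldr foldr_partial_deriv_0)

section \<open>Continuity from bounds on the partial derivatives\<close>

lemma abs_diff_le_partials:
  fixes f :: "real ^ 'd::finite \<Rightarrow> real"
  assumes "has_partials f"
    and B: "\<And>i z. z \<in> cbox (\<chi> k. min (x $ k) (y $ k)) (\<chi> k. max (x $ k) (y $ k)) \<Longrightarrow> \<bar>partial_deriv i f z\<bar> \<le> B"
  shows "\<bar>f y - f x\<bar> \<le> B * (\<Sum>i\<in>UNIV. \<bar>y $ i - x $ i\<bar>)"
proof -
  \<comment> \<open>\<open>S\<close> holds the coordinates already changed from \<open>x\<close> to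
    \<open>y\<close>. Adding one coordinate moves along a single axis, where the one-dimensional
    mean value inequality applies, and all intermediate points stay in the box spanned by
    \<open>x\<close> and \<open>y\<close>.\<close>
  have "\<bar>f (\<chi> k. if k \<in> S then y $ k else x $ k) - f x\<bar> \<le> B * (\<Sum>i\<in>S. \<bar>y $ i - x $ i\<bar>)"
    if "finite S" for S
    using that
  proof (induction S)
    case (insert i S)
    define z where "z = (\<chi> k. if k \<in> S then y $ k else x $ k)"
    let ?c = "\<lambda>t. z + t *\<^sub>R axis i 1"
    define h where "h = y $ i - x $ i"
    have z': "(\<chi> k. if k \<in> insert i S then y $ k else x $ k) = ?c h"
      using insert.hyps by (auto simp: vec_eq_iff z_def h_def axis_def)
    have "norm (f (?c h) - f (?c 0)) \<le> B * norm (h - 0)"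
    proof (rule field_differentiable_bound[where S = "closed_segment 0 h"])
      fix t assume t: "t \<in> closed_segment 0 h"
      show "((\<lambda>t. f (?c t)) has_field_derivative partial_deriv i f (?c t)) (at t within closed_segment 0 h)"
        by (rule has_field_derivative_at_within[OF has_partials_DERIV[OF assms(1)]])
      have "?c t \<in> cbox (\<chi> k. min (x $ k) (y $ k)) (\<chi> k. max (x $ k) (y $ k))"
        using t insert.hyps
        by (auto simp: mem_box_cart z_def h_def axis_def closed_segment_eq_real_ivl split: if_splits)
      then show "norm (partial_deriv i f (?c t)) \<le> B"
        using B by simp
    qed auto
    then have "\<bar>f (?c h) - f z\<bar> \<le> B * \<bar>y $ i - x $ i\<bar>"
      by (simp add: h_def)
    moreover have "\<bar>f z - f x\<bar> \<le> B * (\<Sum>i\<in>S. \<bar>y $ i - x $ i\<bar>)"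
      using insert.IH by (simp add: z_def)
    ultimately show ?case
      unfolding z' using insert.hyps by (simp add: distrib_left)
  qed simp
  from this[of UNIV] show ?thesis
    by simp
qed

text \<open>Bounds on the partial derivatives make \<open>f\<close> Lipschitz near each point. Hence
  smoothness can be read off from existence and local bounds of the partial derivatives of all
  orders.\<close>

lemma continuous_if_partials_locally_bounded:
  fixes f :: "real ^ 'd::finite \<Rightarrow> real"
  assumes "has_partials f"
    and "\<And>i K. compact K \<Longrightarrow> \<exists>B. \<forall>x\<in>K. \<bar>partial_deriv i f x\<bar> \<le> B"
  shows "continuous_on UNIV f"
  unfolding continuous_on_def
proof
  fix x :: "real ^ 'd"
  let ?K = "cbox (\<chi> k. x $ k - 1) (\<chi> k. x $ k + 1)"
  obtain b where b: "\<And>i z. z \<in> ?K \<Longrightarrow> \<bar>partial_deriv i f z\<bar> \<le> b i"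
    using assms(2)[of ?K] by (metis compact_cbox)
  define B where "B = (\<Sum>i\<in>UNIV. \<bar>b i\<bar>)"
  have B: "\<bar>partial_deriv i f z\<bar> \<le> B" if "z \<in> ?K" for i z
    using b[OF that, of i] member_le_sum[of i UNIV "\<lambda>i. \<bar>b i\<bar>"] by (simp add: B_def)
  have "\<forall>\<^sub>F y in at x. dist y x < 1"
    using eventually_at[of "\<lambda>y. dist y x < 1" x UNIV] zero_less_one by blast
  then have "\<forall>\<^sub>F y in at x. norm (f y - f x) \<le> B * (\<Sum>i\<in>UNIV. \<bar>y $ i - x $ i\<bar>)"
  proof eventually_elim
    case (elim y)
    have k: "x $ k - 1 \<le> y $ k" "y $ k \<le> x $ k + 1" for k
      using component_le_norm_cart[of "y - x" k] elim by (auto simp: dist_norm)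
    have "cbox (\<chi> k. min (x $ k) (y $ k)) (\<chi> k. max (x $ k) (y $ k)) \<subseteq> ?K"
    proof (intro subsetI, unfold mem_box_cart, intro allI)
      fix z i assume "\<forall>i. (\<chi> k. min (x $ k) (y $ k)) $ i \<le> z $ i \<and> z $ i \<le> (\<chi> k. max (x $ k) (y $ k)) $ i"
      then have "min (x $ i) (y $ i) \<le> z $ i" "z $ i \<le> max (x $ i) (y $ i)"
        by simp_all
      then show "(\<chi> k. x $ k - 1) $ i \<le> z $ i \<and> z $ i \<le> (\<chi> k. x $ k + 1) $ i"
        using k[of i] by auto
    qed
    then show ?case
      using abs_diff_le_partials[OF assms(1), of x y B] B by auto
  qed
  moreover have "((\<lambda>y. B * (\<Sum>i\<in>UNIV. \<bar>y $ i - x $ i\<bar>)) \<longlongrightarrow> B * (\<Sum>i\<in>UNIV. \<bar>x $ i - x $ i\<bar>)) (at x)"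
    by (intro tendsto_intros)
  then have "((\<lambda>y. B * (\<Sum>i\<in>UNIV. \<bar>y $ i - x $ i\<bar>)) \<longlongrightarrow> 0) (at x)"
    by simp
  ultimately have "((\<lambda>y. f y - f x) \<longlongrightarrow> 0) (at x)"
    by (rule Lim_null_comparison)
  then show "(f \<longlongrightarrow> f x) (at x within UNIV)"
    by (simp add: LIM_zero_iff)
qed

section \<open>Growth conditions\<close>

text \<open>Abstracts from the two growth conditions so that each estimate is proved once: with
  \<open>moderate\<close> it yields membership in \<open>E_M\<close>, with
  \<open>negligible_family\<close> membership in \<open>N_M\<close>. The clause mixing
  \<open>moderate\<close> with \<open>g\<close> is the ideal property, and the last clause compares
  families on (0,1] only, where they are defined.\<close>

definition growth_ideal :: "((real \<Rightarrow> real) \<Rightarrow> bool) \<Rightarrow> bool" where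
  "growth_ideal g \<longleftrightarrow> g (\<lambda>_. 0) \<and> (\<forall>r s. g r \<and> g s \<longrightarrow> g (\<lambda>\<epsilon>. r \<epsilon> + s \<epsilon>)) \<and>
     (\<forall>r s. moderate r \<and> g s \<longrightarrow> g (\<lambda>\<epsilon>. r \<epsilon> * s \<epsilon>)) \<and>
     (\<forall>r s. g r \<and> (\<forall>\<epsilon>\<in>{0<..1}. \<bar>s \<epsilon>\<bar> \<le> \<bar>r \<epsilon>\<bar>) \<longrightarrow> g s)"

lemma growth_ideal_0: "growth_ideal g \<Longrightarrow> g (\<lambda>_. 0)"
  and growth_ideal_add: "growth_ideal g \<Longrightarrow> g r \<Longrightarrow> g s \<Longrightarrow> g (\<lambda>\<epsilon>. r \<epsilon> + s \<epsilon>)"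
  and growth_ideal_mult: "growth_ideal g \<Longrightarrow> moderate r \<Longrightarrow> g s \<Longrightarrow> g (\<lambda>\<epsilon>. r \<epsilon> * s \<epsilon>)"
  and growth_ideal_mono: "growth_ideal g \<Longrightarrow> g r \<Longrightarrow> (\<And>\<epsilon>. \<epsilon> \<in> {0<..1} \<Longrightarrow> \<bar>s \<epsilon>\<bar> \<le> \<bar>r \<epsilon>\<bar>) \<Longrightarrow> g s"
  unfolding growth_ideal_def by blast+

lemma eventually_at_right_unit: "\<forall>\<^sub>F \<epsilon> in at_right (0::real). \<epsilon> \<in> {0<..1}"
  using eventually_at_right_real[of 0 1] by (auto elim!: eventually_mono)

lemma bigo_unit_mono:
  fixes r s f :: "real \<Rightarrow> real"
  assumes "r \<in> O[at_right 0](f)" "\<And>\<epsilon>. \<epsilon> \<in> {0<..1} \<Longrightarrow> \<bar>s \<epsilon>\<bar> \<le> \<bar>r \<epsilon>\<bar>"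
  shows "s \<in> O[at_right 0](f)"
proof -
  have "\<forall>\<^sub>F \<epsilon> in at_right 0. norm (s \<epsilon>) \<le> norm (r \<epsilon>)"
    by (rule eventually_mono[OF eventually_at_right_unit]) (simp add: assms(2))
  then have "s \<in> O[at_right 0](r)"
    by (rule landau_o.big_mono)
  then show ?thesis
    using assms(1) landau_o.big_trans by blast
qed

lemma powr_bigo_mono:
  assumes "a \<le> b"
  shows "(\<lambda>\<epsilon>. \<epsilon> powr b) \<in> O[at_right 0](\<lambda>\<epsilon>. \<epsilon> powr a :: real)"
  using eventually_at_right_unit
  by (intro landau_o.big_mono) (auto elim!: eventually_mono intro: powr_mono' assms)

lemma moderate_const: "moderate (\<lambda>_. c)"
proof -
  have "\<forall>\<^sub>F \<epsilon> in at_right 0. norm c \<le> \<bar>c\<bar> * norm (\<epsilon> powr (- 0) :: real)"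
    by (rule eventually_mono[OF eventually_at_right_unit]) simp
  then have "(\<lambda>_. c) \<in> O[at_right 0](\<lambda>\<epsilon>. \<epsilon> powr (- 0) :: real)"
    by (rule bigoI)
  then show ?thesis
    unfolding moderate_def by blast
qed

lemma moderate_add:
  assumes "moderate r" "moderate s"
  shows "moderate (\<lambda>\<epsilon>. r \<epsilon> + s \<epsilon>)"
proof -
  obtain a b where ab: "a \<ge> 0" "b \<ge> 0" "r \<in> O[at_right 0](\<lambda>\<epsilon>. \<epsilon> powr (- a))"
      "s \<in> O[at_right 0](\<lambda>\<epsilon>. \<epsilon> powr (- b))"
    using assms by (auto simp: moderate_def)
  have "r \<in> O[at_right 0](\<lambda>\<epsilon>. \<epsilon> powr (- max a b))" "s \<in> O[at_right 0](\<lambda>\<epsilon>. \<epsilon> powr (- max a b))"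
    by (rule landau_o.big_trans[OF ab(3) powr_bigo_mono] landau_o.big_trans[OF ab(4) powr_bigo_mono]; simp)+
  then show ?thesis
    unfolding moderate_def using ab(1) by (intro exI[of _ "max a b"]) (auto intro: sum_in_bigo)
qed

lemma moderate_mult:
  assumes "moderate r" "moderate s"
  shows "moderate (\<lambda>\<epsilon>. r \<epsilon> * s \<epsilon>)"
proof -
  obtain a b where ab: "a \<ge> 0" "b \<ge> 0" "r \<in> O[at_right 0](\<lambda>\<epsilon>. \<epsilon> powr (- a))"
      "s \<in> O[at_right 0](\<lambda>\<epsilon>. \<epsilon> powr (- b))"
    using assms by (auto simp: moderate_def)
  then have "(\<lambda>\<epsilon>. r \<epsilon> * s \<epsilon>) \<in> O[at_right 0](\<lambda>\<epsilon>. \<epsilon> powr (- a) * \<epsilon> powr (- b))"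
    by (intro landau_o.big_mult)
  then show ?thesis
    unfolding moderate_def using ab(1,2) by (intro exI[of _ "a + b"]) (auto simp: powr_add[symmetric])
qed

lemma negligible_family_moderate_mult:
  assumes "moderate r" "negligible_family s"
  shows "negligible_family (\<lambda>\<epsilon>. r \<epsilon> * s \<epsilon>)"
  unfolding negligible_family_def
proof (intro allI impI)
  fix b :: real assume "b \<ge> 0"
  obtain a where a: "a \<ge> 0" "r \<in> O[at_right 0](\<lambda>\<epsilon>. \<epsilon> powr (- a))"
    using assms(1) by (auto simp: moderate_def)
  \<comment> \<open>The exponent is raised by \<open>a\<close> in advance, to make up for the factor
    \<epsilon>^(-a) lost to \<open>r\<close>.\<close>
  have "s \<in> O[at_right 0](\<lambda>\<epsilon>. \<epsilon> powr (a + b))"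
    using assms(2) a(1) \<open>b \<ge> 0\<close> by (simp add: negligible_family_def)
  with a(2) have "(\<lambda>\<epsilon>. r \<epsilon> * s \<epsilon>) \<in> O[at_right 0](\<lambda>\<epsilon>. \<epsilon> powr (- a) * \<epsilon> powr (a + b))"
    by (intro landau_o.big_mult)
  then show "(\<lambda>\<epsilon>. r \<epsilon> * s \<epsilon>) \<in> O[at_right 0](\<lambda>\<epsilon>. \<epsilon> powr b)"
    by (simp add: powr_add[symmetric])
qed

lemma growth_ideal_moderate: "growth_ideal moderate"
  unfolding growth_ideal_def
proof (intro conjI allI impI)
  fix r s assume "moderate r \<and> (\<forall>\<epsilon>\<in>{0<..1}. \<bar>s \<epsilon>\<bar> \<le> \<bar>r \<epsilon>\<bar>)"
  then show "moderate s"
    unfolding moderate_def using bigo_unit_mono by blast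
qed (use moderate_const moderate_add moderate_mult in auto)

lemma growth_ideal_negligible: "growth_ideal negligible_family"
  unfolding growth_ideal_def
proof (intro conjI allI impI)
  fix r s assume "negligible_family r \<and> (\<forall>\<epsilon>\<in>{0<..1}. \<bar>s \<epsilon>\<bar> \<le> \<bar>r \<epsilon>\<bar>)"
  then show "negligible_family s"
    unfolding negligible_family_def using bigo_unit_mono by blast
qed (use negligible_family_moderate_mult in \<open>auto simp: negligible_family_def intro: sum_in_bigo\<close>)

lemma moderate_prod:
  "finite A \<Longrightarrow> (\<And>x. x \<in> A \<Longrightarrow> moderate (r x)) \<Longrightarrow> moderate (\<lambda>\<epsilon>. \<Prod>x\<in>A. r x \<epsilon>)"
  by (induction A rule: finite_induct) (auto intro: moderate_const moderate_mult)

text \<open>An explicit bound stands in for the supremum over \<open>K\<close>. It is meaningful for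
  the empty set and carries boundedness with it, while a real supremum of an empty or unbounded set
  is unspecified.\<close>

definition locally_of_growth ::
    "((real \<Rightarrow> real) \<Rightarrow> bool) \<Rightarrow> (real \<Rightarrow> 'a::topological_space \<Rightarrow> real) \<Rightarrow> bool" where
  "locally_of_growth g F \<longleftrightarrow>
     (\<forall>K. compact K \<longrightarrow> (\<exists>r. g r \<and> (\<forall>\<epsilon>\<in>{0<..1}. \<forall>x\<in>K. \<bar>F \<epsilon> x\<bar> \<le> r \<epsilon>)))"

lemma locally_of_growthD:
  assumes "locally_of_growth g F" "compact K"
  shows "\<exists>r. g r \<and> (\<forall>\<epsilon>\<in>{0<..1}. \<forall>x\<in>K. \<bar>F \<epsilon> x\<bar> \<le> r \<epsilon>)"
  using assms by (simp add: locally_of_growth_def)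

lemma locally_of_growth_cong:
  assumes "\<And>\<epsilon>. \<epsilon> \<in> {0<..1} \<Longrightarrow> F \<epsilon> = G \<epsilon>"
  shows "locally_of_growth g F \<longleftrightarrow> locally_of_growth g G"
proof -
  have "(\<forall>\<epsilon>\<in>{0<..1}. \<forall>x\<in>K. \<bar>F \<epsilon> x\<bar> \<le> r \<epsilon>) \<longleftrightarrow> (\<forall>\<epsilon>\<in>{0<..1}. \<forall>x\<in>K. \<bar>G \<epsilon> x\<bar> \<le> r \<epsilon>)" for K r
    by (rule ball_cong) (simp_all add: assms)
  then show ?thesis
    by (simp only: locally_of_growth_def)
qed

lemma locally_of_growth_SUP:
  fixes F :: "real \<Rightarrow> 'a::topological_space \<Rightarrow> real"
  assumes "growth_ideal g"
    and "\<And>\<epsilon> K. \<epsilon> \<in> {0<..1} \<Longrightarrow> compact K \<Longrightarrow> bdd_above ((\<lambda>x. \<bar>F \<epsilon> x\<bar>) ` K)"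
  shows "locally_of_growth g F \<longleftrightarrow>
    (\<forall>K. compact K \<and> K \<noteq> {} \<longrightarrow> g (\<lambda>\<epsilon>. SUP x\<in>K. \<bar>F \<epsilon> x\<bar>))"
proof (intro iffI allI impI)
  fix K :: "'a set" assume F: "locally_of_growth g F" and K: "compact K \<and> K \<noteq> {}"
  then obtain r where r: "g r" "\<forall>\<epsilon>\<in>{0<..1}. \<forall>x\<in>K. \<bar>F \<epsilon> x\<bar> \<le> r \<epsilon>"
    using locally_of_growthD[OF F] by blast
  from K obtain x where "x \<in> K"
    by auto
  show "g (\<lambda>\<epsilon>. SUP x\<in>K. \<bar>F \<epsilon> x\<bar>)"
  proof (rule growth_ideal_mono[OF assms(1) r(1)])
    fix \<epsilon> :: real assume \<epsilon>: "\<epsilon> \<in> {0<..1}"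
    have "(SUP x\<in>K. \<bar>F \<epsilon> x\<bar>) \<le> r \<epsilon>"
      using K r(2) \<epsilon> by (auto intro: cSUP_least)
    \<comment> \<open>A point of \<open>K\<close> shows that the supremum is nonnegative, so the
      upper bound also bounds its absolute value.\<close>
    moreover have "\<bar>F \<epsilon> x\<bar> \<le> (SUP x\<in>K. \<bar>F \<epsilon> x\<bar>)"
      using K by (intro cSUP_upper \<open>x \<in> K\<close> assms(2)[OF \<epsilon>]) auto
    ultimately show "\<bar>SUP x\<in>K. \<bar>F \<epsilon> x\<bar>\<bar> \<le> \<bar>r \<epsilon>\<bar>"
      by linarith
  qed
next
  assume *: "\<forall>K. compact K \<and> K \<noteq> {} \<longrightarrow> g (\<lambda>\<epsilon>. SUP x\<in>K. \<bar>F \<epsilon> x\<bar>)"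
  show "locally_of_growth g F"
    unfolding locally_of_growth_def
  proof (intro allI impI)
    fix K :: "'a set" assume K: "compact K"
    show "\<exists>r. g r \<and> (\<forall>\<epsilon>\<in>{0<..1}. \<forall>x\<in>K. \<bar>F \<epsilon> x\<bar> \<le> r \<epsilon>)"
    proof (cases "K = {}")
      case True
      then show ?thesis
        using growth_ideal_0[OF assms(1)] by auto
    next
      case False
      then show ?thesis
        using * K assms(2) by (intro exI[of _ "\<lambda>\<epsilon>. SUP x\<in>K. \<bar>F \<epsilon> x\<bar>"]) (auto intro: cSUP_upper)
    qed
  qed
qed

text \<open>Derivatives of smooth functions are continuous, hence bounded on compact sets, so the
  suprema in \<open>smooth_families\<close> are genuine and can be traded for explicit
  bounds.\<close>

lemma smooth_families_iff:
  assumes "growth_ideal g"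
  shows "u \<in> smooth_families g \<longleftrightarrow>
    (\<forall>\<epsilon>\<in>{0<..1}. smooth (u \<epsilon>)) \<and> (\<forall>\<alpha>. locally_of_growth g (\<lambda>\<epsilon>. multi_deriv \<alpha> (u \<epsilon>)))"
proof -
  have "bdd_above ((\<lambda>x. \<bar>multi_deriv \<alpha> (u \<epsilon>) x\<bar>) ` K)" if "smooth (u \<epsilon>)" "compact K" for \<epsilon> K \<alpha>
    unfolding multi_deriv_eq_foldr using that
    by (intro bounded_imp_bdd_above compact_imp_bounded compact_continuous_image continuous_intros)
      (auto intro: continuous_on_subset[OF smooth_continuous])
  then have "locally_of_growth g (\<lambda>\<epsilon>. multi_deriv \<alpha> (u \<epsilon>)) \<longleftrightarrow>
      (\<forall>K. compact K \<and> K \<noteq> {} \<longrightarrow> g (\<lambda>\<epsilon>. SUP x\<in>K. \<bar>multi_deriv \<alpha> (u \<epsilon>) x\<bar>))"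
    if "\<forall>\<epsilon>\<in>{0<..1}. smooth (u \<epsilon>)" for \<alpha>
    using that by (intro locally_of_growth_SUP[OF assms]) auto
  then show ?thesis
    by (auto simp: smooth_families_def)
qed

lemma locally_of_growth_linear:
  fixes F G :: "real \<Rightarrow> 'a::topological_space \<Rightarrow> real"
  assumes "growth_ideal g" "locally_of_growth g F" "locally_of_growth g G"
  shows "locally_of_growth g (\<lambda>\<epsilon> x. a * F \<epsilon> x + b * G \<epsilon> x)"
  unfolding locally_of_growth_def
proof (intro allI impI)
  fix K :: "'a set" assume "compact K"
  obtain r where r: "g r" "\<forall>\<epsilon>\<in>{0<..1}. \<forall>x\<in>K. \<bar>F \<epsilon> x\<bar> \<le> r \<epsilon>"
    using locally_of_growthD[OF assms(2) \<open>compact K\<close>] by blast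
  obtain s where s: "g s" "\<forall>\<epsilon>\<in>{0<..1}. \<forall>x\<in>K. \<bar>G \<epsilon> x\<bar> \<le> s \<epsilon>"
    using locally_of_growthD[OF assms(3) \<open>compact K\<close>] by blast
  have "\<bar>a * F \<epsilon> x + b * G \<epsilon> x\<bar> \<le> \<bar>a\<bar> * r \<epsilon> + \<bar>b\<bar> * s \<epsilon>" if "\<epsilon> \<in> {0<..1}" "x \<in> K" for \<epsilon> x
    using mult_left_mono[OF r(2)[rule_format, OF that], of "\<bar>a\<bar>"]
      mult_left_mono[OF s(2)[rule_format, OF that], of "\<bar>b\<bar>"]
      abs_triangle_ineq[of "a * F \<epsilon> x" "b * G \<epsilon> x"] by (simp add: abs_mult)
  moreover have "g (\<lambda>\<epsilon>. \<bar>a\<bar> * r \<epsilon> + \<bar>b\<bar> * s \<epsilon>)"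
    using growth_ideal_add[of g "\<lambda>\<epsilon>. \<bar>a\<bar> * r \<epsilon>" "\<lambda>\<epsilon>. \<bar>b\<bar> * s \<epsilon>"] assms(1) r(1) s(1)
      growth_ideal_mult[of g "\<lambda>_. \<bar>a\<bar>" r] growth_ideal_mult[of g "\<lambda>_. \<bar>b\<bar>" s] moderate_const
    by simp
  ultimately show "\<exists>r. g r \<and> (\<forall>\<epsilon>\<in>{0<..1}. \<forall>x\<in>K. \<bar>a * F \<epsilon> x + b * G \<epsilon> x\<bar> \<le> r \<epsilon>)"
    by blast
qed

lemma smooth_families_linear:
  assumes "growth_ideal g" "u \<in> smooth_families g" "v \<in> smooth_families g"
  shows "(\<lambda>\<epsilon> x. a * u \<epsilon> x + b * v \<epsilon> x) \<in> smooth_families g"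
proof -
  have *: "\<forall>\<epsilon>\<in>{0<..1}. smooth (u \<epsilon>)" "\<forall>\<epsilon>\<in>{0<..1}. smooth (v \<epsilon>)"
      "\<And>\<alpha>. locally_of_growth g (\<lambda>\<epsilon>. multi_deriv \<alpha> (u \<epsilon>))" "\<And>\<alpha>. locally_of_growth g (\<lambda>\<epsilon>. multi_deriv \<alpha> (v \<epsilon>))"
    using assms by (auto simp: smooth_families_iff)
  have "multi_deriv \<alpha> (\<lambda>x. a * u \<epsilon> x + b * v \<epsilon> x) = (\<lambda>x. a * multi_deriv \<alpha> (u \<epsilon>) x + b * multi_deriv \<alpha> (v \<epsilon>) x)"
    if "\<epsilon> \<in> {0<..1}" for \<alpha> \<epsilon>
    using *(1,2) that by (intro multi_deriv_linear) auto
  then have "locally_of_growth g (\<lambda>\<epsilon>. multi_deriv \<alpha> (\<lambda>x. a * u \<epsilon> x + b * v \<epsilon> x))" for \<alpha>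
    using locally_of_growth_linear[OF assms(1) *(3,4)[of \<alpha>], of a b]
    by (subst locally_of_growth_cong) auto
  then show ?thesis
    using * by (auto simp: smooth_families_iff[OF assms(1)] smooth_linear)
qed

text \<open>\<open>S\<close> is an invariant: starting from \<open>F\<close>, no iterated partial
  derivative leaves it. Continuity of a member is derived rather than required, because its partial
  derivatives are again members and hence locally bounded.\<close>

lemma smooth_families_coinduct:
  assumes "growth_ideal g" "F \<in> S"
    and partials: "\<And>G \<epsilon>. G \<in> S \<Longrightarrow> \<epsilon> \<in> {0<..1} \<Longrightarrow> has_partials (G \<epsilon>)"
    and growth: "\<And>G. G \<in> S \<Longrightarrow> locally_of_growth g G"
    and step: "\<And>G i. G \<in> S \<Longrightarrow> \<exists>G'\<in>S. \<forall>\<epsilon>\<in>{0<..1}. partial_deriv i (G \<epsilon>) = G' \<epsilon>"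
  shows "F \<in> smooth_families g"
proof -
  have iter: "\<exists>G\<in>S. \<forall>\<epsilon>\<in>{0<..1}. foldr partial_deriv is (F \<epsilon>) = G \<epsilon>" for "is"
  proof (induction "is")
    case (Cons i "is")
    then obtain G where G: "G \<in> S" "\<forall>\<epsilon>\<in>{0<..1}. foldr partial_deriv is (F \<epsilon>) = G \<epsilon>"
      by blast
    with step[OF G(1), of i] show ?case
      by simp
  qed (use assms(2) in auto)
  have cont: "continuous_on UNIV (G \<epsilon>)" if "G \<in> S" "\<epsilon> \<in> {0<..1}" for G \<epsilon>
  proof (rule continuous_if_partials_locally_bounded[OF partials[OF that]])
    fix i and K :: "(real ^ 'a::{finite,linorder}) set" assume "compact K"
    obtain G' where "G' \<in> S" "\<forall>\<epsilon>\<in>{0<..1}. partial_deriv i (G \<epsilon>) = G' \<epsilon>"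
      using step[OF \<open>G \<in> S\<close>] by blast
    then show "\<exists>B. \<forall>x\<in>K. \<bar>partial_deriv i (G \<epsilon>) x\<bar> \<le> B"
      using locally_of_growthD[OF growth[of G'] \<open>compact K\<close>] that(2) by fastforce
  qed
  have "smooth (F \<epsilon>)" if "\<epsilon> \<in> {0<..1}" for \<epsilon>
    unfolding smooth_def Let_def using iter partials cont that by metis
  moreover have "locally_of_growth g (\<lambda>\<epsilon>. multi_deriv \<alpha> (F \<epsilon>))" for \<alpha>
  proof -
    obtain G where "G \<in> S" "\<forall>\<epsilon>\<in>{0<..1}. multi_deriv \<alpha> (F \<epsilon>) = G \<epsilon>"
      using iter by (metis multi_deriv_eq_foldr)
    then show ?thesis
      using growth[of G] locally_of_growth_cong[of "\<lambda>\<epsilon>. multi_deriv \<alpha> (F \<epsilon>)" G] by blast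
  qed
  ultimately show ?thesis
    by (simp add: smooth_families_iff[OF assms(1)])
qed

section \<open>The equivalence relation defining the Colombeau algebra\<close>

lemma equiv_colombeau_rel: "equiv E_M colombeau_rel"
proof (rule equivI)
  show "refl_on E_M colombeau_rel"
    using smooth_0 growth_ideal_0[OF growth_ideal_negligible]
    by (auto simp: refl_on_def colombeau_rel_def N_M_def smooth_families_def multi_deriv_0)
  show "colombeau_rel \<subseteq> E_M \<times> E_M"
    by (auto simp: colombeau_rel_def)
  show "sym colombeau_rel"
  proof (rule symI)
    fix u v assume *: "(u, v) \<in> colombeau_rel"
    then show "(v, u) \<in> colombeau_rel"
      \<comment> \<open>Symmetry is the case of coefficients -1 and 0: the second copy of the
        difference is a dummy.\<close>
      using smooth_families_linear[OF growth_ideal_negligible, of "\<lambda>\<epsilon> x. u \<epsilon> x - v \<epsilon> x" "\<lambda>\<epsilon> x. u \<epsilon> x - v \<epsilon> x" "-1" 0]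
      by (auto simp: colombeau_rel_def N_M_def)
  qed
  show "trans colombeau_rel"
  proof (rule transI)
    fix u v w assume "(u, v) \<in> colombeau_rel" "(v, w) \<in> colombeau_rel"
    then show "(u, w) \<in> colombeau_rel"
      using smooth_families_linear[OF growth_ideal_negligible, of "\<lambda>\<epsilon> x. u \<epsilon> x - v \<epsilon> x" "\<lambda>\<epsilon> x. v \<epsilon> x - w \<epsilon> x" 1 1]
      by (auto simp: colombeau_rel_def N_M_def)
  qed
qed

section \<open>Differentiation under the expectation\<close>

text \<open>The fundamental theorem of calculus for left Riemann sums: on each subinterval the
  increment of \<open>g\<close> is the step times \<open>g'\<close> at an intermediate point, and
  uniform continuity of \<open>g'\<close> moves that point to the left end.\<close>

lemma riemann_sum_derivative_limit:
  fixes g g' :: "real \<Rightarrow> real"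
  assumes "a \<le> b" and der: "\<And>t. (g has_real_derivative g' t) (at t)" and cont: "continuous_on UNIV g'"
  shows "(\<lambda>n. \<Sum>k<Suc n. (b - a) / Suc n * g' (a + k * ((b - a) / Suc n))) \<longlonglongrightarrow> g b - g a"
proof (rule LIMSEQ_I)
  fix e :: real assume "0 < e"
  \<comment> \<open>The summand 1 keeps the denominator positive when \<open>a = b\<close>; the
    factor 2 leaves room for a strict inequality at the end.\<close>
  define e' where "e' = e / (2 * (b - a + 1))"
  have "0 < e'"
    using \<open>0 < e\<close> assms(1) by (simp add: e'_def)
  have "uniformly_continuous_on {a..b} g'"
    by (intro compact_uniformly_continuous continuous_on_subset[OF cont]) auto
  then obtain d where "0 < d"
      and d: "\<And>s t. s \<in> {a..b} \<Longrightarrow> t \<in> {a..b} \<Longrightarrow> dist t s < d \<Longrightarrow> dist (g' t) (g' s) < e'"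
    using \<open>0 < e'\<close> unfolding uniformly_continuous_on_def by metis
  have "(\<lambda>n. (b - a) * inverse (real (Suc n))) \<longlonglongrightarrow> (b - a) * 0"
    by (intro tendsto_intros LIMSEQ_inverse_real_of_nat)
  then have "\<forall>\<^sub>F n in sequentially. (b - a) / Suc n < d"
    using \<open>0 < d\<close> order_tendstoD(2) by (fastforce simp: divide_inverse)
  then obtain n0 where n0: "\<And>n. n \<ge> n0 \<Longrightarrow> (b - a) / Suc n < d"
    by (auto simp: eventually_sequentially)
  show "\<exists>no. \<forall>n\<ge>no. norm ((\<Sum>k<Suc n. (b - a) / Suc n * g' (a + k * ((b - a) / Suc n))) - (g b - g a)) < e"
  proof (intro exI[of _ n0] allI impI)
    fix n assume "n \<ge> n0"
    define h where "h = (b - a) / Suc n"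
    have h: "0 \<le> h" "h < d" "Suc n * h = b - a"
      using assms(1) n0[OF \<open>n \<ge> n0\<close>] by (auto simp: h_def simp del: of_nat_Suc)
    define x where "x k = a + real k * h" for k
    have step: "\<bar>h * g' (x k) - (g (x (Suc k)) - g (x k))\<bar> \<le> h * e'" if "k < Suc n" for k
    \<comment> \<open>The step vanishes exactly when \<open>a = b\<close>; the mean value theorem
      asks for a proper interval.\<close>
    proof (cases "h = 0")
      case False
      then have "x k < x (Suc k)"
        using h(1) by (simp add: x_def algebra_simps)
      from MVT2[OF this der] obtain z where z: "x k < z" "z < x (Suc k)"
          "g (x (Suc k)) - g (x k) = (x (Suc k) - x k) * g' z"
        by auto
      have "real (Suc k) * h \<le> real (Suc n) * h"
        using that h(1) by (intro mult_right_mono) auto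
      then have "x (Suc k) \<le> b"
        unfolding x_def h(3) by simp
      moreover have "a \<le> x k" "x (Suc k) - x k = h"
        using h(1) by (auto simp: x_def algebra_simps)
      ultimately have "dist (g' (x k)) (g' z) < e'"
        using z(1,2) h(2) by (intro d) (auto simp: dist_real_def)
      then have "h * \<bar>g' (x k) - g' z\<bar> \<le> h * e'"
        using h(1) by (intro mult_left_mono) (auto simp: dist_real_def)
      then show ?thesis
        unfolding z(3) \<open>x (Suc k) - x k = h\<close> using h(1)
        by (simp add: right_diff_distrib[symmetric] abs_mult)
    qed (simp add: x_def)
    have "(\<Sum>k<Suc n. g (x (Suc k)) - g (x k)) = g b - g a"
      using h(3) sum_lessThan_telescope[of "\<lambda>k. g (x k)" "Suc n"]
      by (simp add: x_def del: sum.lessThan_Suc of_nat_Suc)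
    then have "\<bar>(\<Sum>k<Suc n. h * g' (x k)) - (g b - g a)\<bar> = \<bar>\<Sum>k<Suc n. h * g' (x k) - (g (x (Suc k)) - g (x k))\<bar>"
      by (simp only: sum_subtractf)
    also have "\<dots> \<le> (\<Sum>k<Suc n. h * e')"
      using step by (intro order_trans[OF sum_abs] sum_mono) auto
    also have "\<dots> = (b - a) * e'"
      using h(3) by (simp only: sum_constant card_lessThan) (simp only: mult.assoc[symmetric])
    also have "\<dots> < e"
    proof -
      have "(b - a) / (2 * (b - a + 1)) < 1"
        using assms(1) by (simp add: divide_less_eq)
      from mult_strict_left_mono[OF this \<open>0 < e\<close>] show ?thesis
        by (simp add: e'_def mult.commute)
    qed
    finally show "norm ((\<Sum>k<Suc n. (b - a) / Suc n * g' (a + k * ((b - a) / Suc n))) - (g b - g a)) < e"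
      by (simp only: h_def x_def real_norm_def)
  qed
qed

text \<open>Fatou's lemma for the Riemann sums avoids any question of joint measurability.\<close>

lemma integral_abs_increment_le_ordered:
  fixes f f' :: "real \<Rightarrow> 'w \<Rightarrow> real"
  assumes "a \<le> b"
    and AE: "AE \<omega> in M. (\<forall>t. ((\<lambda>t. f t \<omega>) has_real_derivative f' t \<omega>) (at t)) \<and> continuous_on UNIV (\<lambda>t. f' t \<omega>)"
    and f: "integrable M (f a)" "integrable M (f b)"
    and f': "\<And>t. t \<in> {a..b} \<Longrightarrow> integrable M (f' t)"
    and C: "\<And>t. t \<in> {a..b} \<Longrightarrow> (\<integral>\<omega>. \<bar>f' t \<omega>\<bar> \<partial>M) \<le> C"
  shows "(\<integral>\<omega>. \<bar>f b \<omega> - f a \<omega>\<bar> \<partial>M) \<le> C * (b - a)"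
proof -
  define t where "t n k = a + real k * ((b - a) / Suc n)" for n k
  define D where "D n \<omega> = (\<Sum>k<Suc n. (b - a) / Suc n * f' (t n k) \<omega>)" for n \<omega>
  have t: "t n k \<in> {a..b}" if "k < Suc n" for n k
  proof -
    have "real k * ((b - a) / Suc n) \<le> real (Suc n) * ((b - a) / Suc n)"
      using that assms(1) by (intro mult_right_mono) auto
    then show ?thesis
      using assms(1) by (simp add: t_def del: of_nat_Suc)
  qed
  have int_D: "integrable M (D n)" for n
    unfolding D_def using f'[OF t] by (intro Bochner_Integration.integrable_sum) auto
  have lim: "AE \<omega> in M. (\<lambda>n. D n \<omega>) \<longlonglongrightarrow> f b \<omega> - f a \<omega>"
    using AE
  proof eventually_elim
    case (elim \<omega>)
    then show ?case
      using riemann_sum_derivative_limit[OF assms(1), of "\<lambda>t. f t \<omega>" "\<lambda>t. f' t \<omega>"]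
      by (simp only: D_def t_def)
  qed
  \<comment> \<open>\<open>C\<close> bounds a nonnegative expectation. Without this,
    \<open>ennreal\<close> would cut a negative bound off at 0 and the final comparison could not be
    read back in the reals.\<close>
  have "0 \<le> C"
    using order_trans[OF integral_nonneg_AE C[of a]] assms(1) by auto
  have D_le: "(\<integral>\<omega>. \<bar>D n \<omega>\<bar> \<partial>M) \<le> C * (b - a)" for n
  proof -
    have "(\<integral>\<omega>. \<bar>D n \<omega>\<bar> \<partial>M) \<le> (\<integral>\<omega>. (\<Sum>k<Suc n. (b - a) / Suc n * \<bar>f' (t n k) \<omega>\<bar>) \<partial>M)"
    proof (rule integral_mono)
      show "integrable M (\<lambda>\<omega>. \<Sum>k<Suc n. (b - a) / Suc n * \<bar>f' (t n k) \<omega>\<bar>)"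
        using f'[OF t] by (intro Bochner_Integration.integrable_sum integrable_mult_right integrable_abs) auto
      show "\<bar>D n \<omega>\<bar> \<le> (\<Sum>k<Suc n. (b - a) / Suc n * \<bar>f' (t n k) \<omega>\<bar>)" for \<omega>
        unfolding D_def using assms(1)
        by (intro order_trans[OF sum_abs] sum_mono) (simp add: abs_mult)
    qed (intro integrable_abs int_D)
    also have "\<dots> = (\<Sum>k<Suc n. (b - a) / Suc n * (\<integral>\<omega>. \<bar>f' (t n k) \<omega>\<bar> \<partial>M))"
      using f'[OF t] by (subst Bochner_Integration.integral_sum) auto
    also have "\<dots> \<le> (\<Sum>k<Suc n. (b - a) / Suc n * C)"
      using C[OF t] assms(1) by (intro sum_mono mult_left_mono) auto
    also have "\<dots> = C * (b - a)"
      by (simp del: of_nat_Suc)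
    finally show ?thesis .
  qed
  \<comment> \<open>The almost sure limit of the sums is read as a lower limit; their L^1 norms are
    bounded uniformly in \<open>n\<close>, and this bound survives in the limit.\<close>
  have "(\<integral>\<^sup>+\<omega>. ennreal \<bar>f b \<omega> - f a \<omega>\<bar> \<partial>M) = (\<integral>\<^sup>+\<omega>. liminf (\<lambda>n. ennreal \<bar>D n \<omega>\<bar>) \<partial>M)"
  proof (intro nn_integral_cong_AE, use lim in eventually_elim)
    case (elim \<omega>)
    then have "(\<lambda>n. ennreal \<bar>D n \<omega>\<bar>) \<longlonglongrightarrow> ennreal \<bar>f b \<omega> - f a \<omega>\<bar>"
      by (intro tendsto_intros)
    then show ?case
      by (intro lim_imp_Liminf[symmetric]) auto
  qed
  also have "\<dots> \<le> liminf (\<lambda>n. \<integral>\<^sup>+\<omega>. ennreal \<bar>D n \<omega>\<bar> \<partial>M)"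
    using int_D by (intro nn_integral_liminf) auto
  also have "\<dots> = liminf (\<lambda>n. ennreal (\<integral>\<omega>. \<bar>D n \<omega>\<bar> \<partial>M))"
    using int_D by (subst nn_integral_eq_integral) auto
  also have "\<dots> \<le> liminf (\<lambda>n. ennreal (C * (b - a)))"
    using D_le by (intro Liminf_mono always_eventually allI ennreal_leI)
  also have "\<dots> = ennreal (C * (b - a))"
    by (simp add: Liminf_const)
  finally have "ennreal (\<integral>\<omega>. \<bar>f b \<omega> - f a \<omega>\<bar> \<partial>M) \<le> ennreal (C * (b - a))"
    using f by (subst (asm) nn_integral_eq_integral) auto
  then show ?thesis
    using \<open>0 \<le> C\<close> assms(1) by (simp add: ennreal_le_iff)
qed

text \<open>The two-sided derivative at 0 calls for increments in both directions, whence the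
  unordered segment.\<close>

lemma integral_abs_increment_le:
  fixes f f' :: "real \<Rightarrow> 'w \<Rightarrow> real"
  assumes "AE \<omega> in M. (\<forall>t. ((\<lambda>t. f t \<omega>) has_real_derivative f' t \<omega>) (at t)) \<and> continuous_on UNIV (\<lambda>t. f' t \<omega>)"
    and "\<And>t. t \<in> closed_segment a b \<Longrightarrow> integrable M (f t)"
    and "\<And>t. t \<in> closed_segment a b \<Longrightarrow> integrable M (f' t)"
    and "\<And>t. t \<in> closed_segment a b \<Longrightarrow> (\<integral>\<omega>. \<bar>f' t \<omega>\<bar> \<partial>M) \<le> C"
  shows "(\<integral>\<omega>. \<bar>f b \<omega> - f a \<omega>\<bar> \<partial>M) \<le> C * \<bar>b - a\<bar>"
proof (cases "a \<le> b")
  case True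
  then show ?thesis
    using integral_abs_increment_le_ordered[OF True assms(1)] assms(2-)
    by (simp add: closed_segment_eq_real_ivl)
next
  case False
  then show ?thesis
    using integral_abs_increment_le_ordered[OF _ assms(1), of b a C] assms(2-)
    by (simp add: closed_segment_eq_real_ivl abs_minus_commute)
qed

text \<open>Two uses of the increment estimate bound the Taylor remainder in the mean by C h^2, so
  the difference quotient of the expectation misses the expected derivative by at most
  \<open>C * \<bar>h\<bar>\<close>. The unit interval is merely a convenient neighbourhood of
  0.\<close>

lemma DERIV_under_integral:
  fixes f f' f'' :: "real \<Rightarrow> 'w \<Rightarrow> real"
  assumes AE: "AE \<omega> in M. (\<forall>t. ((\<lambda>t. f t \<omega>) has_real_derivative f' t \<omega>) (at t)) \<and>
      (\<forall>t. ((\<lambda>t. f' t \<omega>) has_real_derivative f'' t \<omega>) (at t)) \<and> continuous_on UNIV (\<lambda>t. f'' t \<omega>)"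
    and f: "\<And>t. \<bar>t\<bar> \<le> 1 \<Longrightarrow> integrable M (f t)"
    and f': "\<And>t. \<bar>t\<bar> \<le> 1 \<Longrightarrow> integrable M (f' t)"
    and f'': "\<And>t. \<bar>t\<bar> \<le> 1 \<Longrightarrow> integrable M (f'' t)"
    and C: "\<And>t. \<bar>t\<bar> \<le> 1 \<Longrightarrow> (\<integral>\<omega>. \<bar>f'' t \<omega>\<bar> \<partial>M) \<le> C"
  shows "((\<lambda>t. \<integral>\<omega>. f t \<omega> \<partial>M) has_real_derivative (\<integral>\<omega>. f' 0 \<omega> \<partial>M)) (at 0)"
proof -
  have "0 \<le> C"
    using order_trans[OF integral_nonneg_AE C[of 0]] by auto
  have seg: "\<bar>s\<bar> \<le> \<bar>t\<bar>" if "s \<in> closed_segment 0 t" for s t :: real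
    using that by (auto simp: closed_segment_eq_real_ivl split: if_splits)
  have f'_incr: "(\<integral>\<omega>. \<bar>f' t \<omega> - f' 0 \<omega>\<bar> \<partial>M) \<le> C * \<bar>t\<bar>" if "\<bar>t\<bar> \<le> 1" for t
  proof -
    have seg1: "\<bar>s\<bar> \<le> 1" if "s \<in> closed_segment 0 t" for s
      using seg[OF that] \<open>\<bar>t\<bar> \<le> 1\<close> by linarith
    \<comment> \<open>The increment estimate for \<open>f'\<close>, with \<open>f''\<close> as the
      derivative.\<close>
    have "(\<integral>\<omega>. \<bar>f' t \<omega> - f' 0 \<omega>\<bar> \<partial>M) \<le> C * \<bar>t - 0\<bar>"
    proof (rule integral_abs_increment_le)
      show "AE \<omega> in M. (\<forall>t. ((\<lambda>t. f' t \<omega>) has_real_derivative f'' t \<omega>) (at t)) \<and> continuous_on UNIV (\<lambda>t. f'' t \<omega>)"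
        using AE by eventually_elim blast
    qed (use seg1 f' f'' C in blast)+
    then show ?thesis
      by simp
  qed
  have remainder: "(\<integral>\<omega>. \<bar>f h \<omega> - h * f' 0 \<omega> - f 0 \<omega>\<bar> \<partial>M) \<le> C * \<bar>h\<bar> * \<bar>h\<bar>" if "\<bar>h\<bar> \<le> 1" for h
  proof -
    have seg1: "\<bar>s\<bar> \<le> 1" if "s \<in> closed_segment 0 h" for s
      using seg[OF that] \<open>\<bar>h\<bar> \<le> 1\<close> by linarith
    \<comment> \<open>Now for \<open>f t - t * f' 0\<close>, whose derivative
      \<open>f' t - f' 0\<close> has just been bounded in the mean by
      \<open>C * \<bar>h\<bar>\<close> on the whole segment.\<close>
    have "(\<integral>\<omega>. \<bar>(f h \<omega> - h * f' 0 \<omega>) - (f 0 \<omega> - 0 * f' 0 \<omega>)\<bar> \<partial>M) \<le> C * \<bar>h\<bar> * \<bar>h - 0\<bar>"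
    proof (rule integral_abs_increment_le)
      show "AE \<omega> in M. (\<forall>t. ((\<lambda>t. f t \<omega> - t * f' 0 \<omega>) has_real_derivative f' t \<omega> - f' 0 \<omega>) (at t)) \<and>
          continuous_on UNIV (\<lambda>t. f' t \<omega> - f' 0 \<omega>)"
        using AE
      proof eventually_elim
        case (elim \<omega>)
        then have "isCont (\<lambda>t. f' t \<omega>) t" for t
          using DERIV_isCont by blast
        then have "continuous_on UNIV (\<lambda>t. f' t \<omega>)"
          by (simp add: continuous_on_eq_continuous_at)
        then show ?case
          using elim by (auto intro!: derivative_eq_intros continuous_intros)
      qed
      fix t assume t: "t \<in> closed_segment 0 h"
      show "integrable M (\<lambda>\<omega>. f t \<omega> - t * f' 0 \<omega>)" "integrable M (\<lambda>\<omega>. f' t \<omega> - f' 0 \<omega>)"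
        using f f' seg1[OF t] by auto
      show "(\<integral>\<omega>. \<bar>f' t \<omega> - f' 0 \<omega>\<bar> \<partial>M) \<le> C * \<bar>h\<bar>"
        using f'_incr[OF seg1[OF t]] mult_left_mono[OF seg[OF t] \<open>0 \<le> C\<close>] by linarith
    qed
    then show ?thesis
      by simp
  qed
  let ?F = "\<lambda>t. \<integral>\<omega>. f t \<omega> \<partial>M" and ?D = "\<integral>\<omega>. f' 0 \<omega> \<partial>M"
  have quot: "norm ((?F (0 + h) - ?F 0) / h - ?D) \<le> C * \<bar>h\<bar>" if "\<bar>h\<bar> \<le> 1" "h \<noteq> 0" for h
  proof -
    have "\<bar>?F h - h * ?D - ?F 0\<bar> = \<bar>\<integral>\<omega>. f h \<omega> - h * f' 0 \<omega> - f 0 \<omega> \<partial>M\<bar>"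
      using f[of h] f[of 0] f'[of 0] that by simp
    also have "\<dots> \<le> C * \<bar>h\<bar> * \<bar>h\<bar>"
      by (rule order_trans[OF integral_abs_bound remainder[OF that(1)]])
    finally have "\<bar>?F h - h * ?D - ?F 0\<bar> / \<bar>h\<bar> \<le> C * \<bar>h\<bar>"
      using that(2) by (simp add: divide_le_eq)
    moreover have "(?F (0 + h) - ?F 0) / h - ?D = (?F h - h * ?D - ?F 0) / h"
      using that(2) by (simp add: field_simps)
    ultimately show ?thesis
      by (simp add: abs_divide)
  qed
  have "\<forall>\<^sub>F h in at (0::real). h \<in> ball 0 1 - {0}"
    by (rule eventually_at_in_open) auto
  then have "\<forall>\<^sub>F h in at 0. norm ((?F (0 + h) - ?F 0) / h - ?D) \<le> C * \<bar>h\<bar>"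
    by eventually_elim (rule quot; simp)
  moreover have "((\<lambda>h. C * \<bar>h\<bar>) \<longlongrightarrow> C * \<bar>0\<bar>) (at (0::real))"
    by (intro tendsto_intros)
  then have "((\<lambda>h. C * \<bar>h\<bar>) \<longlongrightarrow> 0) (at (0::real))"
    by simp
  ultimately have "((\<lambda>h. (?F (0 + h) - ?F 0) / h - ?D) \<longlongrightarrow> 0) (at 0)"
    by (rule Lim_null_comparison)
  then show ?thesis
    unfolding DERIV_def by (simp add: LIM_zero_iff)
qed

section \<open>Products of functions in \<open>L\<^sup>q\<close>\<close>

text \<open>If no factor exceeds 1, neither does the product; otherwise the largest factor
  \<open>m\<close> exceeds 1 and its \<open>q\<close>-th power alone dominates. This is how the
  hypothesis that the number of factors is at most \<open>q\<close> enters.\<close>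

lemma prod_le_one_plus_sum_powr:
  fixes y :: "'i \<Rightarrow> real"
  assumes "finite A" "\<And>i. i \<in> A \<Longrightarrow> 0 \<le> y i" "real (card A) \<le> q"
  shows "(\<Prod>i\<in>A. y i) \<le> 1 + (\<Sum>i\<in>A. y i powr q)"
proof (cases "\<forall>i\<in>A. y i \<le> 1")
  case True
  then have "(\<Prod>i\<in>A. y i) \<le> 1"
    using assms(2) by (intro prod_le_1) auto
  moreover have "0 \<le> (\<Sum>i\<in>A. y i powr q)"
    by (intro sum_nonneg) auto
  ultimately show ?thesis
    by linarith
next
  case False
  then have "A \<noteq> {}"
    by auto
  define m where "m = Max (y ` A)"
  have le_m: "y i \<le> m" if "i \<in> A" for i
    using assms(1) that by (simp add: m_def)
  have "m \<in> y ` A"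
    unfolding m_def using assms(1) \<open>A \<noteq> {}\<close> by (intro Max_in) auto
  then obtain j where j: "j \<in> A" "y j = m"
    by auto
  have "1 < m"
    using False le_m by force
  have "(\<Prod>i\<in>A. y i) \<le> m ^ card A"
    using le_m assms(2) by (intro order_trans[OF prod_mono[of A y "\<lambda>_. m"]]) auto
  also have "\<dots> = m powr real (card A)"
    using \<open>1 < m\<close> by (simp add: powr_realpow)
  also have "\<dots> \<le> m powr q"
    using \<open>1 < m\<close> assms(3) by (intro powr_mono) auto
  also have "\<dots> \<le> (\<Sum>i\<in>A. y i powr q)"
    using j assms(1) member_le_sum[of j A "\<lambda>i. y i powr q"] by auto
  finally show ?thesis
    by simp
qed

lemma (in prob_space) Lq_norm_nonneg: "0 \<le> Lq_norm M q f"
proof -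
  have "esssup M (\<lambda>\<omega>. ereal 0) \<le> esssup M (\<lambda>\<omega>. ereal \<bar>f \<omega>\<bar>)"
    by (intro esssup_mono) auto
  then have "0 \<le> esssup M (\<lambda>\<omega>. ereal \<bar>f \<omega>\<bar>)"
    by (subst (asm) esssup_const) (auto simp: emeasure_space_1 zero_ereal_def)
  then show ?thesis
    by (auto simp: Lq_norm_def real_of_ereal_pos)
qed

lemma (in prob_space) Lq_norm_infinity_AE:
  assumes "in_Lq M \<infinity> f"
  shows "AE \<omega> in M. \<bar>f \<omega>\<bar> \<le> Lq_norm M \<infinity> f"
proof -
  let ?e = "esssup M (\<lambda>\<omega>. ereal \<bar>f \<omega>\<bar>)"
  \<comment> \<open>Infinite values have to be excluded on both sides, since
    \<open>real_of_ereal\<close> sends them to 0.\<close>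
  have "esssup M (\<lambda>\<omega>. ereal 0) \<le> ?e"
    by (intro esssup_mono) auto
  then have "0 \<le> ?e"
    by (subst (asm) esssup_const) (auto simp: emeasure_space_1 zero_ereal_def)
  moreover have "?e < \<infinity>"
    using assms by (simp add: in_Lq_def)
  ultimately have "ereal (real_of_ereal ?e) = ?e"
    by (intro ereal_real') auto
  then show ?thesis
    using esssup_AE[where M = M and f = "\<lambda>\<omega>. ereal \<bar>f \<omega>\<bar>"] by (auto simp: Lq_norm_def elim!: eventually_mono) (metis ereal_less_eq(3))
qed

text \<open>Normalization by a positive upper bound \<open>n\<close> instead of the norm, which may
  vanish; it brings all factors of a product to scale 1.\<close>

lemma (in prob_space) integral_powr_le_of_Lq_norm:
  assumes "in_Lq M q f" "q \<noteq> \<infinity>" "1 \<le> q" "Lq_norm M q f \<le> n" "0 < n"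
  shows "integrable M (\<lambda>\<omega>. (\<bar>f \<omega>\<bar> / n) powr real_of_ereal q)"
    and "(\<integral>\<omega>. (\<bar>f \<omega>\<bar> / n) powr real_of_ereal q \<partial>M) \<le> 1"
proof -
  obtain r where r: "q = ereal r" "1 \<le> r"
    using assms(2,3) by (cases q) auto
  let ?I = "\<integral>\<omega>. \<bar>f \<omega>\<bar> powr r \<partial>M"
  have eq: "(\<bar>f \<omega>\<bar> / n) powr r = \<bar>f \<omega>\<bar> powr r / n powr r" for \<omega>
    using assms(5) by (simp add: powr_divide)
  have int: "integrable M (\<lambda>\<omega>. \<bar>f \<omega>\<bar> powr r)"
    using assms(1,2) r by (simp add: in_Lq_def)
  then show "integrable M (\<lambda>\<omega>. (\<bar>f \<omega>\<bar> / n) powr real_of_ereal q)"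
    by (simp add: r eq)
  have "?I = (?I powr (1 / r)) powr r"
    using r(2) by (simp add: powr_powr)
  also have "\<dots> \<le> n powr r"
    using assms(4) r by (intro powr_mono2) (auto simp: Lq_norm_def)
  finally show "(\<integral>\<omega>. (\<bar>f \<omega>\<bar> / n) powr real_of_ereal q \<partial>M) \<le> 1"
    using assms(5) by (simp add: r eq)
qed

text \<open>After division of each factor by its bound, the product lies below an integrable
  majorant. Its expectation is at most 1 from the constant term plus 1 for each normalized factor,
  which is the origin of \<open>1 + card A\<close>.\<close>

lemma (in prob_space) prod_Lq_bound_pos:
  fixes n :: "'i \<Rightarrow> real"
  assumes "finite A" "\<And>i. i \<in> A \<Longrightarrow> in_Lq M q (f i)" "1 \<le> q" "ereal (real (card A)) \<le> q"
    and n: "\<And>i. i \<in> A \<Longrightarrow> 0 < n i" "\<And>i. i \<in> A \<Longrightarrow> Lq_norm M q (f i) \<le> n i"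
  shows "integrable M (\<lambda>\<omega>. \<Prod>i\<in>A. f i \<omega>)"
    and "(\<integral>\<omega>. \<bar>\<Prod>i\<in>A. f i \<omega>\<bar> \<partial>M) \<le> (1 + card A) * (\<Prod>i\<in>A. n i)"
proof -
  \<comment> \<open>The majorant of the normalized product. For \<open>q = \<infinity>\<close> each
    normalized factor is almost surely at most 1, so the constant 1 suffices.\<close>
  define w where "w \<omega> = (if q = \<infinity> then 1 else 1 + (\<Sum>i\<in>A. (\<bar>f i \<omega>\<bar> / n i) powr real_of_ereal q))" for \<omega>
  have [measurable]: "f i \<in> borel_measurable M" if "i \<in> A" for i
    using assms(2)[OF that] by (simp add: in_Lq_def)
  have N: "0 < (\<Prod>i\<in>A. n i)"
    using n(1) by (intro prod_pos) auto
  have w: "integrable M w" "(\<integral>\<omega>. w \<omega> \<partial>M) \<le> 1 + card A"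
  proof -
    have "integrable M w \<and> (\<integral>\<omega>. w \<omega> \<partial>M) \<le> 1 + card A"
    proof (cases "q = \<infinity>")
      case True
      then show ?thesis
        by (simp add: w_def[abs_def] prob_space)
    next
      case False
      note * = integral_powr_le_of_Lq_norm[OF assms(2) False assms(3) n(2) n(1)]
      have "(\<integral>\<omega>. (\<Sum>i\<in>A. (\<bar>f i \<omega>\<bar> / n i) powr real_of_ereal q) \<partial>M)
          = (\<Sum>i\<in>A. \<integral>\<omega>. (\<bar>f i \<omega>\<bar> / n i) powr real_of_ereal q \<partial>M)"
        using *(1) by (intro Bochner_Integration.integral_sum) auto
      also have "\<dots> \<le> (\<Sum>i\<in>A. 1)"
        using *(2) by (intro sum_mono) auto
      finally show ?thesis
        using False *(1) by (simp add: w_def[abs_def] prob_space)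
    qed
    then show "integrable M w" "(\<integral>\<omega>. w \<omega> \<partial>M) \<le> 1 + card A"
      by auto
  qed
  have le: "AE \<omega> in M. \<bar>\<Prod>i\<in>A. f i \<omega>\<bar> \<le> (\<Prod>i\<in>A. n i) * w \<omega>"
  proof -
    have "AE \<omega> in M. (\<Prod>i\<in>A. \<bar>f i \<omega>\<bar> / n i) \<le> w \<omega>"
    proof (cases "q = \<infinity>")
      case True
      have "AE \<omega> in M. \<forall>i\<in>A. \<bar>f i \<omega>\<bar> \<le> n i"
      proof (rule AE_finite_allI[OF assms(1)])
        fix i assume i: "i \<in> A"
        have "AE \<omega> in M. \<bar>f i \<omega>\<bar> \<le> Lq_norm M q (f i)"
          using Lq_norm_infinity_AE assms(2)[OF i] True by blast
        then show "AE \<omega> in M. \<bar>f i \<omega>\<bar> \<le> n i"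
          by eventually_elim (rule order_trans[OF _ n(2)[OF i]])
      qed
      then show ?thesis
        using n(1) by (auto simp: w_def True field_simps intro!: prod_le_1 elim!: eventually_mono)
    next
      case False
      then have "real (card A) \<le> real_of_ereal q"
        using assms(3,4) by (cases q) auto
      then have "(\<Prod>i\<in>A. \<bar>f i \<omega>\<bar> / n i) \<le> w \<omega>" for \<omega>
        using prod_le_one_plus_sum_powr[OF assms(1), of "\<lambda>i. \<bar>f i \<omega>\<bar> / n i" "real_of_ereal q"] n(1) False
        by (simp add: w_def less_imp_le)
      then show ?thesis
        by simp
    qed
    then show ?thesis
    proof eventually_elim
      case (elim \<omega>)
      then show ?case
        using N by (simp add: prod_dividef abs_prod divide_le_eq mult.commute)
    qed
  qed
  have Nw: "integrable M (\<lambda>\<omega>. (\<Prod>i\<in>A. n i) * w \<omega>)"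
    using w(1) by simp
  show int: "integrable M (\<lambda>\<omega>. \<Prod>i\<in>A. f i \<omega>)"
    by (rule Bochner_Integration.integrable_bound[OF Nw]) (use le in \<open>auto elim!: eventually_mono\<close>)
  have "(\<integral>\<omega>. \<bar>\<Prod>i\<in>A. f i \<omega>\<bar> \<partial>M) \<le> (\<integral>\<omega>. (\<Prod>i\<in>A. n i) * w \<omega> \<partial>M)"
    using int Nw le by (intro integral_mono_AE) auto
  also have "\<dots> \<le> (\<Prod>i\<in>A. n i) * (1 + card A)"
    using N w(2) by simp
  finally show "(\<integral>\<omega>. \<bar>\<Prod>i\<in>A. f i \<omega>\<bar> \<partial>M) \<le> (1 + card A) * (\<Prod>i\<in>A. n i)"
    by (simp add: mult.commute)
qed

text \<open>A crude form of Hoelder's inequality: the constant \<open>1 + card A\<close> is irrelevant for growth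
  estimates and makes the proof elementary.\<close>

lemma (in prob_space) prod_Lq_bound:
  fixes n :: "'i \<Rightarrow> real"
  assumes "finite A" "\<And>i. i \<in> A \<Longrightarrow> in_Lq M q (f i)" "1 \<le> q" "ereal (real (card A)) \<le> q"
    and n: "\<And>i. i \<in> A \<Longrightarrow> Lq_norm M q (f i) \<le> n i"
  shows "integrable M (\<lambda>\<omega>. \<Prod>i\<in>A. f i \<omega>)"
    and "(\<integral>\<omega>. \<bar>\<Prod>i\<in>A. f i \<omega>\<bar> \<partial>M) \<le> (1 + card A) * (\<Prod>i\<in>A. n i)"
proof -
  have n0: "0 \<le> n i" if "i \<in> A" for i
    by (rule order_trans[OF Lq_norm_nonneg n[OF that]])
  \<comment> \<open>Bounds equal to 0 cannot be divided by; all bounds are raised by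
    \<open>d > 0\<close>, and \<open>d\<close> tends to 0 at the end.\<close>
  have *: "integrable M (\<lambda>\<omega>. \<Prod>i\<in>A. f i \<omega>) \<and>
      (\<integral>\<omega>. \<bar>\<Prod>i\<in>A. f i \<omega>\<bar> \<partial>M) \<le> (1 + card A) * (\<Prod>i\<in>A. n i + d)" if "0 < d" for d
    using prod_Lq_bound_pos[where n = "\<lambda>i. n i + d", OF assms(1-4)] n0 n that
    by (simp add: add_nonneg_pos add_increasing2)
  show "integrable M (\<lambda>\<omega>. \<Prod>i\<in>A. f i \<omega>)"
    using *[of 1] by simp
  have "((\<lambda>d. (1 + card A) * (\<Prod>i\<in>A. n i + d)) \<longlongrightarrow> (1 + card A) * (\<Prod>i\<in>A. n i + 0)) (at_right 0)"
    by (intro tendsto_intros)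
  moreover have "\<forall>\<^sub>F d in at_right 0. (\<integral>\<omega>. \<bar>\<Prod>i\<in>A. f i \<omega>\<bar> \<partial>M) \<le> (1 + card A) * (\<Prod>i\<in>A. n i + d)"
    by (rule eventually_mono[OF eventually_at_right_less]) (use * in auto)
  ultimately have "(\<integral>\<omega>. \<bar>\<Prod>i\<in>A. f i \<omega>\<bar> \<partial>M) \<le> (1 + card A) * (\<Prod>i\<in>A. n i + 0)"
    by (rule tendsto_lowerbound) simp
  then show "(\<integral>\<omega>. \<bar>\<Prod>i\<in>A. f i \<omega>\<bar> \<partial>M) \<le> (1 + card A) * (\<Prod>i\<in>A. n i)"
    by simp
qed

section \<open>Random fields with derivatives in \<open>L\<^sup>q\<close>\<close>

text \<open>Preimages under \<open>f\<close> and \<open>g\<close> differ by a null set, hence are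
  measurable together in a complete space. This serves derivatives in different orders, which are
  known to agree only on the smooth paths.\<close>

lemma (in complete_measure) borel_measurable_AE_eq:
  fixes f g :: "'a \<Rightarrow> real"
  assumes "g \<in> borel_measurable M" "AE \<omega> in M. f \<omega> = g \<omega>"
  shows "f \<in> borel_measurable M"
proof (rule measurableI)
  fix B :: "real set" assume "B \<in> sets borel"
  then have "g -` B \<inter> space M \<in> sets M"
    using assms(1) by measurable
  moreover have "AE \<omega> in M. \<omega> \<in> g -` B \<inter> space M \<longleftrightarrow> \<omega> \<in> f -` B \<inter> space M"
    using assms(2) by eventually_elim auto
  ultimately show "f -` B \<inter> space M \<in> sets M"
    using in_sets_AE by blast
qed auto

lemma (in complete_measure)
  assumes "in_Lq M q g" "AE \<omega> in M. f \<omega> = g \<omega>"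
  shows in_Lq_AE_eq: "in_Lq M q f" and Lq_norm_AE_eq: "Lq_norm M q f = Lq_norm M q g"
proof -
  have g: "g \<in> borel_measurable M"
    using assms(1) by (simp add: in_Lq_def)
  then have f: "f \<in> borel_measurable M"
    by (rule borel_measurable_AE_eq) (rule assms(2))
  have ess: "esssup M (\<lambda>\<omega>. ereal \<bar>f \<omega>\<bar>) = esssup M (\<lambda>\<omega>. ereal \<bar>g \<omega>\<bar>)"
    using f g assms(2) by (intro esssup_AE_cong) (auto elim!: eventually_mono)
  have pow: "AE \<omega> in M. \<bar>f \<omega>\<bar> powr r = \<bar>g \<omega>\<bar> powr r" for r
    using assms(2) by eventually_elim simp
  have "integrable M (\<lambda>\<omega>. \<bar>f \<omega>\<bar> powr r) \<longleftrightarrow> integrable M (\<lambda>\<omega>. \<bar>g \<omega>\<bar> powr r)" for r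
    using f g pow by (intro integrable_cong_AE) auto
  moreover have "(\<integral>\<omega>. \<bar>f \<omega>\<bar> powr r \<partial>M) = (\<integral>\<omega>. \<bar>g \<omega>\<bar> powr r \<partial>M)" for r
    using f g pow by (intro integral_cong_AE) auto
  ultimately show "in_Lq M q f" "Lq_norm M q f = Lq_norm M q g"
    using assms(1) f ess by (auto simp: in_Lq_def Lq_norm_def split: if_splits)
qed

definition field_deriv ::
    "'d::finite list \<Rightarrow> (real \<Rightarrow> real ^ 'd::finite \<Rightarrow> 'w \<Rightarrow> real) \<Rightarrow> real \<Rightarrow> real ^ 'd \<Rightarrow> 'w \<Rightarrow> real" where
  "field_deriv is v = (\<lambda>\<epsilon> x \<omega>. foldr partial_deriv is (\<lambda>y. v \<epsilon> y \<omega>) x)"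

lemma field_deriv_Nil [simp]: "field_deriv [] v = v"
  by (simp add: field_deriv_def)

lemma field_deriv_append: "field_deriv is (field_deriv js v) = field_deriv (is @ js) v"
  by (simp add: field_deriv_def)

text \<open>Unlike \<^const>\<open>Lq_families\<close>, this class controls derivatives in every order of
  differentiation, which makes it visibly closed under differentiation.\<close>

definition Lq_fields ::
    "'w measure \<Rightarrow> ereal \<Rightarrow> ((real \<Rightarrow> real) \<Rightarrow> bool) \<Rightarrow> (real \<Rightarrow> real ^ 'd::finite \<Rightarrow> 'w \<Rightarrow> real) set" where
  "Lq_fields M q g = {v. (AE \<omega> in M. \<forall>\<epsilon>\<in>{0<..1}. smooth (\<lambda>x. v \<epsilon> x \<omega>)) \<and>
     (\<forall>is. (\<forall>\<epsilon>\<in>{0<..1}. \<forall>x. in_Lq M q (field_deriv is v \<epsilon> x)) \<and>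
       locally_of_growth g (\<lambda>\<epsilon> x. Lq_norm M q (field_deriv is v \<epsilon> x)))}"

lemma Lq_fields_smooth: "v \<in> Lq_fields M q g \<Longrightarrow> AE \<omega> in M. \<forall>\<epsilon>\<in>{0<..1}. smooth (\<lambda>x. v \<epsilon> x \<omega>)"
  and Lq_fields_deriv_in_Lq: "v \<in> Lq_fields M q g \<Longrightarrow> \<epsilon> \<in> {0<..1} \<Longrightarrow> in_Lq M q (field_deriv is v \<epsilon> x)"
  and Lq_fields_deriv_growth: "v \<in> Lq_fields M q g \<Longrightarrow> locally_of_growth g (\<lambda>\<epsilon> x. Lq_norm M q (field_deriv is v \<epsilon> x))"
  by (simp_all add: Lq_fields_def)

lemma Lq_fields_in_Lq: "v \<in> Lq_fields M q g \<Longrightarrow> \<epsilon> \<in> {0<..1} \<Longrightarrow> in_Lq M q (v \<epsilon> x)"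
  and Lq_fields_growth: "v \<in> Lq_fields M q g \<Longrightarrow> locally_of_growth g (\<lambda>\<epsilon> x. Lq_norm M q (v \<epsilon> x))"
  using Lq_fields_deriv_in_Lq[of v M q g \<epsilon> "[]" x] Lq_fields_deriv_growth[of v M q g "[]"] by simp_all

lemma Lq_fields_field_deriv:
  assumes "v \<in> Lq_fields M q g"
  shows "field_deriv is v \<in> Lq_fields M q g"
proof -
  have "AE \<omega> in M. \<forall>\<epsilon>\<in>{0<..1}. smooth (\<lambda>x. field_deriv is v \<epsilon> x \<omega>)"
    using Lq_fields_smooth[OF assms] by eventually_elim (simp add: field_deriv_def smooth_foldr)
  then show ?thesis
    using assms by (simp add: Lq_fields_def field_deriv_append)
qed

text \<open>On almost every path, differentiation along a list is a multi-index derivative.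
  Completeness lets that almost sure identity transport membership in L^q and the value of the
  norm.\<close>

lemma Lq_families_subset_Lq_fields:
  assumes "prob_space M" "growth_ideal g"
  shows "Lq_families M q g \<subseteq> Lq_fields (completion M) q g"
proof
  fix u assume u: "u \<in> Lq_families M q g"
  interpret prob_space "completion M"
    by (rule prob_space.prob_space_completion[OF assms(1)])
  let ?m = "\<lambda>\<alpha> \<epsilon> x \<omega>. multi_deriv \<alpha> (\<lambda>y. u \<epsilon> y \<omega>) x"
  have smooth: "AE \<omega> in completion M. \<forall>\<epsilon>\<in>{0<..1}. smooth (\<lambda>x. u \<epsilon> x \<omega>)"
    using u by (intro AE_completion) (simp add: Lq_families_def)
  have Lq: "in_Lq (completion M) q (?m \<alpha> \<epsilon> x)" if "\<epsilon> \<in> {0<..1}" for \<alpha> \<epsilon> x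
    using u that by (simp add: Lq_families_def)
  have bdd: "bdd_above ((\<lambda>x. \<bar>Lq_norm (completion M) q (?m \<alpha> \<epsilon> x)\<bar>) ` K)"
    if "\<epsilon> \<in> {0<..1}" "compact K" for \<alpha> \<epsilon> K
    using u that by (simp add: Lq_families_def abs_of_nonneg[OF Lq_norm_nonneg])
  have growth: "locally_of_growth g (\<lambda>\<epsilon> x. Lq_norm (completion M) q (?m \<alpha> \<epsilon> x))" for \<alpha>
    using u by (subst locally_of_growth_SUP[OF assms(2) bdd])
      (simp_all add: Lq_families_def abs_of_nonneg[OF Lq_norm_nonneg])
  have eq: "AE \<omega> in completion M. field_deriv is u \<epsilon> x \<omega> = ?m (count (mset is)) \<epsilon> x \<omega>"
    if "\<epsilon> \<in> {0<..1}" for "is" \<epsilon> x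
    using smooth by eventually_elim (use that in \<open>simp add: field_deriv_def foldr_eq_multi_deriv\<close>)
  have "in_Lq (completion M) q (field_deriv is u \<epsilon> x)" if "\<epsilon> \<in> {0<..1}" for "is" \<epsilon> x
    by (rule completion.in_Lq_AE_eq[OF Lq eq]) (rule that)+
  moreover have "locally_of_growth g (\<lambda>\<epsilon> x. Lq_norm (completion M) q (field_deriv is u \<epsilon> x))" for "is"
  proof (subst locally_of_growth_cong)
    show "(\<lambda>x. Lq_norm (completion M) q (field_deriv is u \<epsilon> x))
        = (\<lambda>x. Lq_norm (completion M) q (?m (count (mset is)) \<epsilon> x))" if "\<epsilon> \<in> {0<..1}" for \<epsilon>
      using completion.Lq_norm_AE_eq[OF Lq[OF that] eq[OF that]] by blast
  qed (rule growth)
  ultimately show "u \<in> Lq_fields (completion M) q g"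
    using smooth by (simp add: Lq_fields_def)
qed

section \<open>Expectations of products of random fields\<close>

text \<open>To be interpreted with the completion of the given measure. \<open>p_le_q\<close> is
  what makes products of \<open>p\<close> fields integrable.\<close>

locale Lq_product = prob_space M + complete_measure M for M :: "'w measure" +
  fixes q :: ereal and p :: nat
  assumes one_le_q: "1 \<le> q" and p_le_q: "ereal (real p) \<le> q"
begin

text \<open>The factors may differ: the product rule alters one factor at a time, and the telescoped
  difference of two powers mixes \<open>u\<close>, \<open>v\<close> and
  \<open>u - v\<close>.\<close>

definition moment :: "(nat \<Rightarrow> real \<Rightarrow> real ^ 'd::{finite,linorder} \<Rightarrow> 'w \<Rightarrow> real) \<Rightarrow> real \<Rightarrow> real ^ 'd::{finite,linorder} \<Rightarrow> real" where
  "moment vs \<epsilon> x = (\<integral>\<omega>. (\<Prod>j<p. vs j \<epsilon> x \<omega>) \<partial>M)"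

definition moderate_fields :: "(nat \<Rightarrow> real \<Rightarrow> real ^ 'd::{finite,linorder} \<Rightarrow> 'w \<Rightarrow> real) set" where
  "moderate_fields = {vs. \<forall>j<p. vs j \<in> Lq_fields M q moderate}"

definition deriv_factor :: "'d::{finite,linorder} \<Rightarrow> nat \<Rightarrow> (nat \<Rightarrow> real \<Rightarrow> real ^ 'd::{finite,linorder} \<Rightarrow> 'w \<Rightarrow> real) \<Rightarrow>
    nat \<Rightarrow> real \<Rightarrow> real ^ 'd::{finite,linorder} \<Rightarrow> 'w \<Rightarrow> real" where
  "deriv_factor i j vs = vs(j := field_deriv [i] (vs j))"

lemma deriv_factor_moderate_fields: "vs \<in> moderate_fields \<Longrightarrow> deriv_factor i j vs \<in> moderate_fields"
  by (auto simp: moderate_fields_def deriv_factor_def Lq_fields_field_deriv)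

text \<open>A distinguished factor of growth \<open>g\<close> keeps both its position and its growth
  when any factor is differentiated.\<close>

lemma deriv_factor_Lq_fields: "vs k \<in> Lq_fields M q g \<Longrightarrow> deriv_factor i j vs k \<in> Lq_fields M q g"
  by (auto simp: deriv_factor_def Lq_fields_field_deriv)

lemma integrable_prod:
  assumes "vs \<in> moderate_fields" "\<epsilon> \<in> {0<..1}"
  shows "integrable M (\<lambda>\<omega>. \<Prod>j<p. vs j \<epsilon> x \<omega>)"
  using assms one_le_q p_le_q
  by (intro prod_Lq_bound(1)[where q = q and n = "\<lambda>j. Lq_norm M q (vs j \<epsilon> x)"])
    (auto simp: moderate_fields_def intro: Lq_fields_in_Lq)

text \<open>The factors other than \<open>l\<close> contribute a moderate product of norm bounds and
  factor \<open>l\<close> a bound of growth \<open>g\<close>, so the ideal property applies. With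
  \<open>g\<close> negligible, a single negligible factor makes the whole expectation
  negligible.\<close>

lemma integral_abs_prod_growth:
  fixes vs :: "nat \<Rightarrow> real \<Rightarrow> real ^ 'd::{finite,linorder} \<Rightarrow> 'w \<Rightarrow> real"
  assumes "growth_ideal g" "vs \<in> moderate_fields" "l < p" "vs l \<in> Lq_fields M q g"
  shows "locally_of_growth g (\<lambda>\<epsilon> x. \<integral>\<omega>. \<bar>\<Prod>j<p. vs j \<epsilon> x \<omega>\<bar> \<partial>M)"
  unfolding locally_of_growth_def
proof (intro allI impI)
  fix K :: "(real ^ 'd::{finite,linorder}) set" assume K: "compact K"
  let ?A = "{..<p} - {l}"
  have "\<forall>j\<in>?A. \<exists>r. moderate r \<and> (\<forall>\<epsilon>\<in>{0<..1}. \<forall>x\<in>K. \<bar>Lq_norm M q (vs j \<epsilon> x)\<bar> \<le> r \<epsilon>)"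
  proof
    fix j assume "j \<in> ?A"
    then have "vs j \<in> Lq_fields M q moderate"
      using assms(2) by (simp add: moderate_fields_def)
    from locally_of_growthD[OF Lq_fields_growth[OF this] K]
    show "\<exists>r. moderate r \<and> (\<forall>\<epsilon>\<in>{0<..1}. \<forall>x\<in>K. \<bar>Lq_norm M q (vs j \<epsilon> x)\<bar> \<le> r \<epsilon>)" .
  qed
  from bchoice[OF this] obtain r where
    r: "\<forall>j\<in>?A. moderate (r j) \<and> (\<forall>\<epsilon>\<in>{0<..1}. \<forall>x\<in>K. \<bar>Lq_norm M q (vs j \<epsilon> x)\<bar> \<le> r j \<epsilon>)"
    by blast
  from locally_of_growthD[OF Lq_fields_growth[OF assms(4)] K] obtain s where
    s: "g s" "\<forall>\<epsilon>\<in>{0<..1}. \<forall>x\<in>K. \<bar>Lq_norm M q (vs l \<epsilon> x)\<bar> \<le> s \<epsilon>"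
    by blast
  let ?r = "\<lambda>\<epsilon>. ((1 + real p) * (\<Prod>j\<in>?A. r j \<epsilon>)) * s \<epsilon>"
  have "moderate (\<lambda>\<epsilon>. (1 + real p) * (\<Prod>j\<in>?A. r j \<epsilon>))"
    using r by (intro moderate_mult moderate_const moderate_prod) auto
  then have "g ?r"
    using growth_ideal_mult[OF assms(1)] s(1) by blast
  moreover have "\<bar>\<integral>\<omega>. \<bar>\<Prod>j<p. vs j \<epsilon> x \<omega>\<bar> \<partial>M\<bar> \<le> ?r \<epsilon>" if "\<epsilon> \<in> {0<..1}" "x \<in> K" for \<epsilon> x
  proof -
    define n where "n j = (if j = l then s \<epsilon> else r j \<epsilon>)" for j
    have n: "Lq_norm M q (vs j \<epsilon> x) \<le> n j" if "j < p" for j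
    proof -
      have "\<bar>Lq_norm M q (vs j \<epsilon> x)\<bar> \<le> n j"
        using r s(2) \<open>\<epsilon> \<in> {0<..1}\<close> \<open>x \<in> K\<close> \<open>j < p\<close> by (simp add: n_def)
      then show ?thesis
        by linarith
    qed
    have "(\<integral>\<omega>. \<bar>\<Prod>j<p. vs j \<epsilon> x \<omega>\<bar> \<partial>M) \<le> real (1 + card {..<p}) * (\<Prod>j<p. n j)"
      using assms(2) one_le_q p_le_q n \<open>\<epsilon> \<in> {0<..1}\<close>
      by (intro prod_Lq_bound(2)[where q = q]) (auto simp: moderate_fields_def intro: Lq_fields_in_Lq)
    also have "(\<Prod>j<p. n j) = s \<epsilon> * (\<Prod>j\<in>?A. r j \<epsilon>)"
      using assms(3) by (subst prod.remove[of _ l]) (auto simp: n_def)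
    finally show ?thesis
      by (simp add: mult_ac)
  qed
  ultimately show "\<exists>r. g r \<and> (\<forall>\<epsilon>\<in>{0<..1}. \<forall>x\<in>K. \<bar>\<integral>\<omega>. \<bar>\<Prod>j<p. vs j \<epsilon> x \<omega>\<bar> \<partial>M\<bar> \<le> r \<epsilon>)"
    by blast
qed

lemma moment_growth:
  fixes vs :: "nat \<Rightarrow> real \<Rightarrow> real ^ 'd::{finite,linorder} \<Rightarrow> 'w \<Rightarrow> real"
  assumes "growth_ideal g" "vs \<in> moderate_fields" "l < p" "vs l \<in> Lq_fields M q g"
  shows "locally_of_growth g (moment vs)"
  unfolding locally_of_growth_def
proof (intro allI impI)
  fix K :: "(real ^ 'd::{finite,linorder}) set" assume "compact K"
  from locally_of_growthD[OF integral_abs_prod_growth[OF assms] this] obtain r where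
    r: "g r" "\<forall>\<epsilon>\<in>{0<..1}. \<forall>x\<in>K. \<bar>\<integral>\<omega>. \<bar>\<Prod>j<p. vs j \<epsilon> x \<omega>\<bar> \<partial>M\<bar> \<le> r \<epsilon>"
    by blast
  have "\<bar>moment vs \<epsilon> x\<bar> \<le> \<bar>\<integral>\<omega>. \<bar>\<Prod>j<p. vs j \<epsilon> x \<omega>\<bar> \<partial>M\<bar>" for \<epsilon> x
    unfolding moment_def by (rule order_trans[OF integral_abs_bound abs_ge_self])
  then show "\<exists>r. g r \<and> (\<forall>\<epsilon>\<in>{0<..1}. \<forall>x\<in>K. \<bar>moment vs \<epsilon> x\<bar> \<le> r \<epsilon>)"
    using r order_trans by blast
qed

text \<open>The product rule along a coordinate line, with each term written again as a product of
  all \<open>p\<close> factors, so that it can be differentiated by the same rule.\<close>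

lemma path_DERIV:
  assumes "vs \<in> moderate_fields" "\<epsilon> \<in> {0<..1}"
  shows "AE \<omega> in M. \<forall>t. ((\<lambda>t. \<Prod>j<p. vs j \<epsilon> (x + t *\<^sub>R axis i 1) \<omega>) has_real_derivative
    (\<Sum>j<p. \<Prod>k<p. deriv_factor i j vs k \<epsilon> (x + t *\<^sub>R axis i 1) \<omega>)) (at t)"
proof -
  have "AE \<omega> in M. \<forall>j\<in>{..<p}. \<forall>\<epsilon>\<in>{0<..1}. smooth (\<lambda>x. vs j \<epsilon> x \<omega>)"
    using assms(1) by (intro AE_finite_allI[of "{..<p}"] Lq_fields_smooth) (auto simp: moderate_fields_def)
  then show ?thesis
  proof eventually_elim
    case (elim \<omega>)
    let ?y = "\<lambda>t. x + t *\<^sub>R axis i 1"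
    show ?case
    proof
      fix t
      have factor: "((\<lambda>t. vs j \<epsilon> (?y t) \<omega>) has_real_derivative field_deriv [i] (vs j) \<epsilon> (?y t) \<omega>) (at t)"
        if "j \<in> {..<p}" for j
        using has_partials_DERIV[OF smooth_has_partials[of _ "[]"], of "\<lambda>x. vs j \<epsilon> x \<omega>" x i t] elim that assms(2)
        by (simp add: field_deriv_def)
      have "((\<lambda>t. \<Prod>j<p. vs j \<epsilon> (?y t) \<omega>) has_real_derivative
          (\<Sum>j<p. field_deriv [i] (vs j) \<epsilon> (?y t) \<omega> * (\<Prod>k\<in>{..<p} - {j}. vs k \<epsilon> (?y t) \<omega>))) (at t)"
        by (rule has_field_derivative_prod[OF factor])
      moreover have "field_deriv [i] (vs j) \<epsilon> (?y t) \<omega> * (\<Prod>k\<in>{..<p} - {j}. vs k \<epsilon> (?y t) \<omega>)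
          = (\<Prod>k<p. deriv_factor i j vs k \<epsilon> (?y t) \<omega>)" if "j \<in> {..<p}" for j
        using that by (subst prod.remove[of "{..<p}" j]) (auto simp: deriv_factor_def)
      ultimately show "((\<lambda>t. \<Prod>j<p. vs j \<epsilon> (?y t) \<omega>) has_real_derivative
          (\<Sum>j<p. \<Prod>k<p. deriv_factor i j vs k \<epsilon> (?y t) \<omega>)) (at t)"
        by simp
    qed
  qed
qed

text \<open>Supplies the constant for differentiation under the expectation: the unit segment
  through \<open>x\<close> is compact, so the local bounds hold uniformly on it.\<close>

lemma integral_abs_prod_line_bound:
  assumes "vs \<in> moderate_fields" "\<epsilon> \<in> {0<..1}"
  shows "\<exists>C. \<forall>t. \<bar>t\<bar> \<le> 1 \<longrightarrow> (\<integral>\<omega>. \<bar>\<Prod>j<p. vs j \<epsilon> (x + t *\<^sub>R axis i 1) \<omega>\<bar> \<partial>M) \<le> C"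
proof (cases "p = 0")
  \<comment> \<open>The empty product is the constant 1, and there is no factor from which a bound
    could come.\<close>
  case True
  then show ?thesis
    by (intro exI[of _ 1]) (simp add: prob_space)
next
  case False
  let ?K = "(\<lambda>t. x + t *\<^sub>R axis i 1) ` {-1..1::real}"
  have "compact ?K"
    by (intro compact_continuous_image continuous_intros) auto
  moreover have "locally_of_growth moderate (\<lambda>\<epsilon> x. \<integral>\<omega>. \<bar>\<Prod>j<p. vs j \<epsilon> x \<omega>\<bar> \<partial>M)"
    using assms(1) False
    by (intro integral_abs_prod_growth[of _ _ 0] growth_ideal_moderate) (auto simp: moderate_fields_def)
  ultimately obtain r where
    r: "\<forall>\<epsilon>\<in>{0<..1}. \<forall>y\<in>?K. \<bar>\<integral>\<omega>. \<bar>\<Prod>j<p. vs j \<epsilon> y \<omega>\<bar> \<partial>M\<bar> \<le> r \<epsilon>"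
    using locally_of_growthD by blast
  show ?thesis
  proof (intro exI[of _ "r \<epsilon>"] allI impI)
    fix t :: real assume "\<bar>t\<bar> \<le> 1"
    then have "x + t *\<^sub>R axis i 1 \<in> ?K"
      by (intro imageI) auto
    then show "(\<integral>\<omega>. \<bar>\<Prod>j<p. vs j \<epsilon> (x + t *\<^sub>R axis i 1) \<omega>\<bar> \<partial>M) \<le> r \<epsilon>"
      using r assms(2) abs_le_D1 by blast
  qed
qed

lemma moment_DERIV:
  fixes vs :: "nat \<Rightarrow> real \<Rightarrow> real ^ 'd::{finite,linorder} \<Rightarrow> 'w \<Rightarrow> real"
  assumes "vs \<in> moderate_fields" "\<epsilon> \<in> {0<..1}"
  shows "((\<lambda>t. moment vs \<epsilon> (x + t *\<^sub>R axis i 1)) has_real_derivative (\<Sum>j<p. moment (deriv_factor i j vs) \<epsilon> x)) (at 0)"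
proof -
  define P :: "(nat \<Rightarrow> real \<Rightarrow> real ^ 'd::{finite,linorder} \<Rightarrow> 'w \<Rightarrow> real) \<Rightarrow> real \<Rightarrow> 'w \<Rightarrow> real"
    where "P vs t \<omega> = (\<Prod>j<p. vs j \<epsilon> (x + t *\<^sub>R axis i 1) \<omega>)" for vs t \<omega>
  define f' where "f' t \<omega> = (\<Sum>j<p. P (deriv_factor i j vs) t \<omega>)" for t \<omega>
  define f'' where "f'' t \<omega> = (\<Sum>j<p. \<Sum>k<p. P (deriv_factor i k (deriv_factor i j vs)) t \<omega>)" for t \<omega>
  have P_int: "integrable M (P vs t)" if "vs \<in> moderate_fields" for vs t
    unfolding P_def by (rule integrable_prod[OF that assms(2)])
  have P_deriv: "AE \<omega> in M. \<forall>t. ((\<lambda>t. P vs t \<omega>) has_real_derivative (\<Sum>j<p. P (deriv_factor i j vs) t \<omega>)) (at t)"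
    if "vs \<in> moderate_fields" for vs
    unfolding P_def by (rule path_DERIV[OF that assms(2)])
  note D1 = deriv_factor_moderate_fields[OF assms(1)] and D2 = deriv_factor_moderate_fields[OF deriv_factor_moderate_fields[OF assms(1)]]
  \<comment> \<open>The two indices are packed into a pair so that one use of \<open>choice\<close>
    bounds all terms of the second derivative.\<close>
  have "\<forall>jk. \<exists>C. \<forall>t. \<bar>t\<bar> \<le> 1 \<longrightarrow> (\<integral>\<omega>. \<bar>P (deriv_factor i (snd jk) (deriv_factor i (fst jk) vs)) t \<omega>\<bar> \<partial>M) \<le> C"
    unfolding P_def by (intro allI integral_abs_prod_line_bound[OF D2 assms(2)])
  from choice[OF this] obtain C where
    C: "\<And>jk t. \<bar>t\<bar> \<le> 1 \<Longrightarrow> (\<integral>\<omega>. \<bar>P (deriv_factor i (snd jk) (deriv_factor i (fst jk) vs)) t \<omega>\<bar> \<partial>M) \<le> C jk"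
    by blast
  have "((\<lambda>t. \<integral>\<omega>. P vs t \<omega> \<partial>M) has_real_derivative (\<integral>\<omega>. f' 0 \<omega> \<partial>M)) (at 0)"
  proof (rule DERIV_under_integral)
    have "AE \<omega> in M. \<forall>j\<in>{..<p}. \<forall>t. ((\<lambda>t. P (deriv_factor i j vs) t \<omega>) has_real_derivative (\<Sum>k<p. P (deriv_factor i k (deriv_factor i j vs)) t \<omega>)) (at t)"
      by (intro AE_finite_allI P_deriv D1) auto
    \<comment> \<open>Third derivatives enter through their existence: they make the terms of
      \<open>f''\<close> continuous in \<open>t\<close>.\<close>
    moreover have "AE \<omega> in M. \<forall>j\<in>{..<p}. \<forall>k\<in>{..<p}. \<forall>t. ((\<lambda>t. P (deriv_factor i k (deriv_factor i j vs)) t \<omega>) has_real_derivative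
        (\<Sum>l<p. P (deriv_factor i l (deriv_factor i k (deriv_factor i j vs))) t \<omega>)) (at t)"
      by (intro AE_finite_allI P_deriv D2) auto
    ultimately show "AE \<omega> in M. (\<forall>t. ((\<lambda>t. P vs t \<omega>) has_real_derivative f' t \<omega>) (at t)) \<and>
        (\<forall>t. ((\<lambda>t. f' t \<omega>) has_real_derivative f'' t \<omega>) (at t)) \<and> continuous_on UNIV (\<lambda>t. f'' t \<omega>)"
      using P_deriv[OF assms(1)]
    proof eventually_elim
      case (elim \<omega>)
      have "continuous_on UNIV (\<lambda>t. P (deriv_factor i k (deriv_factor i j vs)) t \<omega>)" if "j < p" "k < p" for j k
      proof -
        have "isCont (\<lambda>t. P (deriv_factor i k (deriv_factor i j vs)) t \<omega>) t" for t
          by (rule DERIV_isCont) (use elim(2) that in blast)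
        then show ?thesis
          by (simp add: continuous_on_eq_continuous_at)
      qed
      then have "continuous_on UNIV (\<lambda>t. f'' t \<omega>)"
        unfolding f''_def by (intro continuous_on_sum) auto
      moreover have "((\<lambda>t. f' t \<omega>) has_real_derivative f'' t \<omega>) (at t)" for t
        unfolding f'_def f''_def using elim(1) by (intro DERIV_sum) auto
      ultimately show ?case
        using elim(3) by (simp add: f'_def)
    qed
    show "integrable M (P vs t)" for t
      by (rule P_int[OF assms(1)])
    show "integrable M (f' t)" for t
      unfolding f'_def by (intro Bochner_Integration.integrable_sum P_int D1)
    show "integrable M (f'' t)" for t
      unfolding f''_def by (intro Bochner_Integration.integrable_sum P_int D2)
    show "(\<integral>\<omega>. \<bar>f'' t \<omega>\<bar> \<partial>M) \<le> (\<Sum>j<p. \<Sum>k<p. C (j, k))" if "\<bar>t\<bar> \<le> 1" for t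
    proof -
      have int: "integrable M (\<lambda>\<omega>. \<bar>P (deriv_factor i k (deriv_factor i j vs)) t \<omega>\<bar>)" for j k
        by (intro integrable_abs P_int D2)
      have "(\<integral>\<omega>. \<bar>f'' t \<omega>\<bar> \<partial>M) \<le> (\<integral>\<omega>. (\<Sum>j<p. \<Sum>k<p. \<bar>P (deriv_factor i k (deriv_factor i j vs)) t \<omega>\<bar>) \<partial>M)"
      proof (rule integral_mono)
        show "integrable M (\<lambda>\<omega>. \<bar>f'' t \<omega>\<bar>)"
          unfolding f''_def by (intro integrable_abs Bochner_Integration.integrable_sum P_int D2)
        show "\<bar>f'' t \<omega>\<bar> \<le> (\<Sum>j<p. \<Sum>k<p. \<bar>P (deriv_factor i k (deriv_factor i j vs)) t \<omega>\<bar>)" for \<omega>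
          unfolding f''_def by (intro order_trans[OF sum_abs] sum_mono) simp
      qed (intro Bochner_Integration.integrable_sum int)
      also have "\<dots> = (\<Sum>j<p. \<Sum>k<p. \<integral>\<omega>. \<bar>P (deriv_factor i k (deriv_factor i j vs)) t \<omega>\<bar> \<partial>M)"
        using int by (simp add: Bochner_Integration.integral_sum)
      also have "\<dots> \<le> (\<Sum>j<p. \<Sum>k<p. C (j, k))"
        using C[OF that, of "(_, _)"] by (intro sum_mono) simp
      finally show ?thesis .
    qed
  qed
  moreover have "(\<integral>\<omega>. f' 0 \<omega> \<partial>M) = (\<Sum>j<p. \<integral>\<omega>. P (deriv_factor i j vs) 0 \<omega> \<partial>M)"
    unfolding f'_def by (intro Bochner_Integration.integral_sum P_int D1)
  ultimately show ?thesis
    by (simp add: P_def moment_def)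
qed

text \<open>Finite sums of moments are closed under differentiation, and every resulting product
  still has a factor of growth \<open>g\<close>. This is the invariant that yields smoothness and
  growth of all derivatives together.\<close>

lemma moment_sum_smooth_families:
  assumes "growth_ideal g" "\<And>vs. vs \<in> set L \<Longrightarrow> vs \<in> moderate_fields \<and> (\<exists>l<p. vs l \<in> Lq_fields M q g)"
  shows "(\<lambda>\<epsilon> x. \<Sum>vs\<leftarrow>L. moment vs \<epsilon> x) \<in> smooth_families g"
proof (rule smooth_families_coinduct[OF assms(1)])
  let ?ok = "\<lambda>vs. vs \<in> moderate_fields \<and> (\<exists>l<p. vs l \<in> Lq_fields M q g)"
  \<comment> \<open>Lists keep repeated tuples, which a set of summands would merge.\<close>
  let ?S = "{\<lambda>\<epsilon> x. \<Sum>vs\<leftarrow>L. moment vs \<epsilon> x | L. \<forall>vs\<in>set L. ?ok vs}"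
  show "(\<lambda>\<epsilon> x. \<Sum>vs\<leftarrow>L. moment vs \<epsilon> x) \<in> ?S"
    using assms(2) by blast
  have deriv: "((\<lambda>t. \<Sum>vs\<leftarrow>L. moment vs \<epsilon> (x + t *\<^sub>R axis i 1)) has_real_derivative
      (\<Sum>vs\<leftarrow>concat (map (\<lambda>vs. map (\<lambda>j. deriv_factor i j vs) [0..<p]) L). moment vs \<epsilon> x)) (at 0)"
    if "\<forall>vs\<in>set L. ?ok vs" "\<epsilon> \<in> {0<..1}" for L \<epsilon> x i
    using that(1)
  proof (induction L)
    case (Cons vs L)
    have "(\<Sum>j\<leftarrow>[0..<p]. moment (deriv_factor i j vs) \<epsilon> x) = (\<Sum>j<p. moment (deriv_factor i j vs) \<epsilon> x)"
      by (simp add: interv_sum_list_conv_sum_set_nat lessThan_atLeast0)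
    then have "((\<lambda>t. moment vs \<epsilon> (x + t *\<^sub>R axis i 1)) has_real_derivative
        (\<Sum>j\<leftarrow>[0..<p]. moment (deriv_factor i j vs) \<epsilon> x)) (at 0)"
      using moment_DERIV[OF _ that(2), of vs x i] Cons.prems by simp
    from DERIV_add[OF this Cons.IH] Cons.prems show ?case
      by (simp add: comp_def)
  qed simp
  fix G assume "G \<in> ?S"
  then obtain L where L: "\<forall>vs\<in>set L. ?ok vs" and G: "G = (\<lambda>\<epsilon> x. \<Sum>vs\<leftarrow>L. moment vs \<epsilon> x)"
    by blast
  show "has_partials (G \<epsilon>)" if "\<epsilon> \<in> {0<..1}" for \<epsilon>
    unfolding has_partials_def G real_differentiable_def using deriv[OF L that] by blast
  show "locally_of_growth g G"
    unfolding G using L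
  proof (induction L)
    case Nil
    show ?case
      using growth_ideal_0[OF assms(1)] by (auto simp: locally_of_growth_def)
  next
    case (Cons vs L)
    then have "locally_of_growth g (moment vs)"
      using moment_growth[OF assms(1)] by auto
    from locally_of_growth_linear[OF assms(1) this Cons.IH, of 1 1] Cons.prems show ?case
      by simp
  qed
  fix i
  \<comment> \<open>Each tuple gives rise to \<open>p\<close> new ones, one for each position at
    which the derivative may fall.\<close>
  let ?L = "concat (map (\<lambda>vs. map (\<lambda>j. deriv_factor i j vs) [0..<p]) L)"
  have "\<forall>vs\<in>set ?L. ?ok vs"
    using L deriv_factor_moderate_fields deriv_factor_Lq_fields by fastforce
  then have mem: "(\<lambda>\<epsilon> x. \<Sum>vs\<leftarrow>?L. moment vs \<epsilon> x) \<in> ?S"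
    by blast
  have eq: "\<forall>\<epsilon>\<in>{0<..1}. partial_deriv i (G \<epsilon>) = (\<lambda>x. \<Sum>vs\<leftarrow>?L. moment vs \<epsilon> x)"
    unfolding G using partial_derivI[OF deriv[OF L]] by blast
  show "\<exists>G'\<in>?S. \<forall>\<epsilon>\<in>{0<..1}. partial_deriv i (G \<epsilon>) = G' \<epsilon>"
    by (intro bexI[OF _ mem]) (rule eq)
qed

end

section \<open>Powers of one field and differences of powers\<close>

lemma smooth_families_cong:
  assumes "growth_ideal g" "\<And>\<epsilon>. \<epsilon> \<in> {0<..1} \<Longrightarrow> u \<epsilon> = v \<epsilon>"
  shows "u \<in> smooth_families g \<longleftrightarrow> v \<in> smooth_families g"
proof -
  have "locally_of_growth g (\<lambda>\<epsilon>. multi_deriv \<alpha> (u \<epsilon>)) \<longleftrightarrow> locally_of_growth g (\<lambda>\<epsilon>. multi_deriv \<alpha> (v \<epsilon>))" for \<alpha>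
    by (rule locally_of_growth_cong) (simp add: assms(2))
  moreover have "(\<forall>\<epsilon>\<in>{0<..1}. smooth (u \<epsilon>)) \<longleftrightarrow> (\<forall>\<epsilon>\<in>{0<..1}. smooth (v \<epsilon>))"
    by (rule ball_cong) (simp_all add: assms(2))
  ultimately show ?thesis
    unfolding smooth_families_iff[OF assms(1)] by simp
qed

text \<open>Factors \<open>b\<close> are turned into \<open>a\<close> from the left, one at a time;
  the summand for \<open>k\<close> is a^k (a - b) b^(p-1-k). Writing it as a product over all
  positions matches the tuples in \<open>moment\<close>.\<close>

lemma power_diff_telescope:
  fixes a b :: "'a::comm_ring_1"
  shows "a ^ p - b ^ p = (\<Sum>k<p. \<Prod>j<p. if j < k then a else if j = k then a - b else b)"
proof (induction p)
  case (Suc p)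
  \<comment> \<open>This belongs to the new summand \<open>k = p\<close>, whose last factor is
    \<open>a - b\<close>; every older summand gains one factor \<open>b\<close>.\<close>
  have "(\<Prod>j<p. if j < p then a else if j = p then a - b else b) = a ^ p"
    by simp
  moreover have "(\<Sum>k<p. \<Prod>j<Suc p. if j < k then a else if j = k then a - b else b) = (a ^ p - b ^ p) * b"
    unfolding Suc.IH sum_distrib_right by (intro sum.cong) auto
  ultimately show ?case
    by (simp add: algebra_simps)
qed simp

context Lq_product
begin

definition power_factors ::
    "(real \<Rightarrow> real ^ 'd::{finite,linorder} \<Rightarrow> 'w \<Rightarrow> real) \<Rightarrow> (real \<Rightarrow> real ^ 'd::{finite,linorder} \<Rightarrow> 'w \<Rightarrow> real) \<Rightarrow>
     nat \<Rightarrow> nat \<Rightarrow> real \<Rightarrow> real ^ 'd::{finite,linorder} \<Rightarrow> 'w \<Rightarrow> real" where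
  "power_factors u v k j = (if j < k then u else if j = k then (\<lambda>\<epsilon> x \<omega>. u \<epsilon> x \<omega> - v \<epsilon> x \<omega>) else v)"

lemma moment_power_diff:
  assumes "u \<in> Lq_fields M q moderate" "v \<in> Lq_fields M q moderate"
    and "(\<lambda>\<epsilon> x \<omega>. u \<epsilon> x \<omega> - v \<epsilon> x \<omega>) \<in> Lq_fields M q moderate" "\<epsilon> \<in> {0<..1}"
  shows "moment (\<lambda>_. u) \<epsilon> x - moment (\<lambda>_. v) \<epsilon> x = (\<Sum>k\<leftarrow>[0..<p]. moment (power_factors u v k) \<epsilon> x)"
proof -
  have int: "integrable M (\<lambda>\<omega>. \<Prod>j<p. power_factors u v k j \<epsilon> x \<omega>)" for k
    using assms by (intro integrable_prod) (auto simp: moderate_fields_def power_factors_def)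
  have "integrable M (\<lambda>\<omega>. \<Prod>j<p. u \<epsilon> x \<omega>)" "integrable M (\<lambda>\<omega>. \<Prod>j<p. v \<epsilon> x \<omega>)"
    using integrable_prod[of "\<lambda>_. u"] integrable_prod[of "\<lambda>_. v"] assms by (auto simp: moderate_fields_def)
  then have "moment (\<lambda>_. u) \<epsilon> x - moment (\<lambda>_. v) \<epsilon> x = (\<integral>\<omega>. u \<epsilon> x \<omega> ^ p - v \<epsilon> x \<omega> ^ p \<partial>M)"
    by (simp add: moment_def)
  also have "\<dots> = (\<integral>\<omega>. (\<Sum>k<p. \<Prod>j<p. power_factors u v k j \<epsilon> x \<omega>) \<partial>M)"
    unfolding power_diff_telescope power_factors_def
    by (intro Bochner_Integration.integral_cong sum.cong prod.cong refl) simp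
  also have "\<dots> = (\<Sum>k<p. moment (power_factors u v k) \<epsilon> x)"
    unfolding moment_def using int by (rule Bochner_Integration.integral_sum)
  finally show ?thesis
    by (simp add: interv_sum_list_conv_sum_set_nat lessThan_atLeast0)
qed

lemma moment_power_diff_negligible:
  assumes "u \<in> Lq_fields M q moderate" "v \<in> Lq_fields M q moderate"
    and "(\<lambda>\<epsilon> x \<omega>. u \<epsilon> x \<omega> - v \<epsilon> x \<omega>) \<in> Lq_fields M q moderate"
    and "(\<lambda>\<epsilon> x \<omega>. u \<epsilon> x \<omega> - v \<epsilon> x \<omega>) \<in> Lq_fields M q negligible_family"
  shows "(\<lambda>\<epsilon> x. moment (\<lambda>_. u) \<epsilon> x - moment (\<lambda>_. v) \<epsilon> x) \<in> smooth_families negligible_family"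
proof -
  have "(\<lambda>\<epsilon> x. \<Sum>vs\<leftarrow>map (power_factors u v) [0..<p]. moment vs \<epsilon> x) \<in> smooth_families negligible_family"
  proof (rule moment_sum_smooth_families[OF growth_ideal_negligible])
    fix vs assume "vs \<in> set (map (power_factors u v) [0..<p])"
    then obtain k where k: "k < p" "vs = power_factors u v k"
      by auto
    \<comment> \<open>The negligible factor \<open>u - v\<close> sits at position \<open>k\<close>
      of the \<open>k\<close>-th tuple.\<close>
    then show "vs \<in> moderate_fields \<and> (\<exists>l<p. vs l \<in> Lq_fields M q negligible_family)"
      using assms by (auto simp: moderate_fields_def power_factors_def intro!: exI[of _ k])
  qed
  then show ?thesis
    by (subst smooth_families_cong[OF growth_ideal_negligible]) (auto simp: moment_power_diff[OF assms(1-3)] comp_def)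
qed

lemma moment_power_moderate:
  assumes "u \<in> Lq_fields M q moderate" "1 \<le> p"
  shows "moment (\<lambda>_. u) \<in> smooth_families moderate"
proof -
  have "(\<lambda>_. u) \<in> moderate_fields \<and> (\<exists>l<p. u \<in> Lq_fields M q moderate)"
    \<comment> \<open>All factors are moderate; \<open>1 \<le> p\<close> makes position 0 available
      as the distinguished one.\<close>
    using assms by (auto simp: moderate_fields_def intro!: exI[of _ 0])
  then show ?thesis
    using moment_sum_smooth_families[OF growth_ideal_moderate, of "[\<lambda>_. u]"] by simp
qed

end

section \<open>Return to the given measure and to the quotient algebras\<close>

lemma negligible_family_moderate: "negligible_family r \<Longrightarrow> moderate r"
  using negligible_family_def[of r] by (auto simp: moderate_def intro!: exI[of _ 0])

lemma N_Lq_subset_E_M_Lq: "N_Lq M q \<subseteq> E_M_Lq M q"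
  by (auto simp: N_Lq_def E_M_Lq_def Lq_families_def negligible_family_moderate)

lemma (in prob_space) in_Lq_0: "in_Lq M q (\<lambda>_. 0)" and Lq_norm_0: "Lq_norm M q (\<lambda>_. 0) = 0"
  using esssup_const[of M "0::ereal"]
  by (simp_all add: in_Lq_def Lq_norm_def emeasure_space_1 zero_ereal_def[symmetric])

text \<open>Gives reflexivity of \<open>colombeau_rel_Lq\<close>: a class contains the
  representative from which it is formed.\<close>

lemma zero_in_N_Lq:
  assumes "prob_space M"
  shows "(\<lambda>\<epsilon> x \<omega>. 0) \<in> N_Lq M q"
proof -
  interpret prob_space "completion M"
    by (rule prob_space.prob_space_completion[OF assms])
  show ?thesis
    using growth_ideal_0[OF growth_ideal_negligible]
    by (auto simp: N_Lq_def Lq_families_def smooth_0 multi_deriv_0 in_Lq_0 Lq_norm_0 image_constant_conv)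
qed

text \<open>The fields themselves, unlike their derivatives, are measurable for \<open>M\<close>, so
  the expectations of their powers are the same under \<open>M\<close> and its completion. The
  values agree on (0,1], which is all that families depend on.\<close>

lemma E_M_Lq_moment:
  fixes u :: "real \<Rightarrow> real ^ 'd::{finite,linorder} \<Rightarrow> 'w \<Rightarrow> real"
  assumes "prob_space M" "1 \<le> q" "1 \<le> p" "ereal (real p) \<le> q" "u \<in> E_M_Lq M q"
  shows "\<epsilon> \<in> {0<..1} \<Longrightarrow> integrable M (\<lambda>\<omega>. u \<epsilon> x \<omega> ^ p)"
    and "moment_family M p u \<in> E_M"
    and "\<epsilon> \<in> {0<..1} \<Longrightarrow> moment_family M p u \<epsilon> = Lq_product.moment (completion M) p (\<lambda>_. u) \<epsilon>"
proof -
  interpret prob_space "completion M"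
    by (rule prob_space.prob_space_completion[OF assms(1)])
  interpret Lq_product "completion M" q p
    by unfold_locales (use assms in auto)
  have u: "u \<in> Lq_fields (completion M) q moderate"
    using Lq_families_subset_Lq_fields[OF assms(1) growth_ideal_moderate] assms(5) by (auto simp: E_M_Lq_def)
  have meas: "(\<lambda>\<omega>. u \<epsilon> x \<omega> ^ p) \<in> borel_measurable M" if "\<epsilon> \<in> {0<..1}" for \<epsilon> x
    using assms(5) that by (intro borel_measurable_power) (simp add: E_M_Lq_def Lq_families_def)
  have eq: "moment_family M p u \<epsilon> = moment (\<lambda>_. u) \<epsilon>" if "\<epsilon> \<in> {0<..1}" for \<epsilon>
    using integral_completion[OF meas[OF that]] by (simp add: moment_family_def moment_def fun_eq_iff)
  then show "\<epsilon> \<in> {0<..1} \<Longrightarrow> moment_family M p u \<epsilon> = moment (\<lambda>_. u) \<epsilon>" .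
  show "integrable M (\<lambda>\<omega>. u \<epsilon> x \<omega> ^ p)" if "\<epsilon> \<in> {0<..1}"
    using integrable_prod[of "\<lambda>_. u", OF _ that, of x] u integrable_completion[OF meas[OF that], of x]
    by (simp add: moderate_fields_def)
  show "moment_family M p u \<in> E_M"
    unfolding E_M_def using moment_power_moderate[OF u assms(3)]
    by (rule smooth_families_cong[OF growth_ideal_moderate, THEN iffD2, rotated]) (rule eq)
qed

lemma moment_family_rel:
  fixes u v :: "real \<Rightarrow> real ^ 'd::{finite,linorder} \<Rightarrow> 'w \<Rightarrow> real"
  assumes "prob_space M" "1 \<le> q" "1 \<le> p" "ereal (real p) \<le> q" "(u, v) \<in> colombeau_rel_Lq M q"
  shows "(moment_family M p u, moment_family M p v) \<in> colombeau_rel"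
proof -
  interpret prob_space "completion M"
    by (rule prob_space.prob_space_completion[OF assms(1)])
  interpret Lq_product "completion M" q p
    by unfold_locales (use assms in auto)
  let ?d = "\<lambda>\<epsilon> x \<omega>. u \<epsilon> x \<omega> - v \<epsilon> x \<omega>"
  \<comment> \<open>The difference plays two parts in the telescoped products: as a moderate field
    it may stand among the factors, as a negligible one it makes each product small.\<close>
  have uv: "u \<in> E_M_Lq M q" "v \<in> E_M_Lq M q" "?d \<in> N_Lq M q" "?d \<in> E_M_Lq M q"
    using assms(5) N_Lq_subset_E_M_Lq by (auto simp: colombeau_rel_Lq_def)
  have sub: "E_M_Lq M q \<subseteq> Lq_fields (completion M) q moderate"
      "N_Lq M q \<subseteq> Lq_fields (completion M) q negligible_family"
    unfolding E_M_Lq_def N_Lq_def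
    by (rule Lq_families_subset_Lq_fields[OF assms(1)] growth_ideal_moderate growth_ideal_negligible)+
  note E = E_M_Lq_moment[OF assms(1-4)]
  have "(\<lambda>\<epsilon> x. moment (\<lambda>_. u) \<epsilon> x - moment (\<lambda>_. v) \<epsilon> x) \<in> smooth_families negligible_family"
    using uv sub by (intro moment_power_diff_negligible) auto
  moreover have "(\<lambda>x. moment_family M p u \<epsilon> x - moment_family M p v \<epsilon> x)
      = (\<lambda>x. moment (\<lambda>_. u) \<epsilon> x - moment (\<lambda>_. v) \<epsilon> x)" if "\<epsilon> \<in> {0<..1}" for \<epsilon>
    by (simp only: E(3)[OF uv(1) that] E(3)[OF uv(2) that])
  ultimately have "(\<lambda>\<epsilon> x. moment_family M p u \<epsilon> x - moment_family M p v \<epsilon> x) \<in> N_M"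
    unfolding N_M_def by (rule smooth_families_cong[OF growth_ideal_negligible, THEN iffD2, rotated])
  then show ?thesis
    using E(2)[OF uv(1)] E(2)[OF uv(2)] by (simp add: colombeau_rel_def)
qed

theorem proposition4p1:
  fixes M :: "'w measure"
    and p' :: ereal
    and p :: nat
    and U :: "(real \<Rightarrow> real ^ 'd::{finite,linorder} \<Rightarrow> 'w \<Rightarrow> real) set"
  assumes "prob_space M"
    and "1 \<le> p'"
    and "U \<in> colombeau_algebra_Lq M p'"
    and "1 \<le> p"
    and "ereal (real p) \<le> p'"
  shows "(\<forall>u\<in>U.
            (\<forall>\<epsilon>\<in>{0<..1}. \<forall>x. integrable M (\<lambda>\<omega>. u \<epsilon> x \<omega> ^ p)) \<and>
            (\<forall>\<epsilon>\<in>{0<..1}. smooth (moment_family M p u \<epsilon>)) \<and>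
            moment_family M p u \<in> E_M) \<and>
         (\<exists>!V. V \<in> colombeau_algebra \<and>
            (\<forall>u\<in>U. colombeau_rel `` {moment_family M p u} = V))"
proof -
  obtain w where w: "w \<in> E_M_Lq M p'" and U: "U = colombeau_rel_Lq M p' `` {w}"
    using assms(3) by (auto simp: colombeau_algebra_Lq_def elim: quotientE)
  note E = E_M_Lq_moment[OF assms(1,2,4,5)]
  have U_sub: "u \<in> E_M_Lq M p'" if "u \<in> U" for u
    using that by (auto simp: U colombeau_rel_Lq_def)
  \<comment> \<open>Uniqueness of \<open>V\<close> rests on this: over an empty \<open>U\<close> the
    condition on \<open>V\<close> would be vacuous.\<close>
  have "w \<in> U"
    using w zero_in_N_Lq[OF assms(1)] by (simp add: U colombeau_rel_Lq_def)
  have smooth: "smooth (moment_family M p u \<epsilon>)" if "u \<in> U" "\<epsilon> \<in> {0<..1}" for u \<epsilon>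
    using E(2)[OF U_sub[OF that(1)]] that(2) by (simp add: E_M_def smooth_families_def)
  let ?V = "colombeau_rel `` {moment_family M p w}"
  have V: "colombeau_rel `` {moment_family M p u} = ?V" if "u \<in> U" for u
    using moment_family_rel[OF assms(1,2,4,5), of w u] that
    by (intro equiv_class_eq[OF equiv_colombeau_rel, symmetric]) (simp add: U)
  have V_mem: "?V \<in> colombeau_algebra"
    unfolding colombeau_algebra_def by (rule quotientI[OF E(2)[OF w]])
  have "\<exists>!V. V \<in> colombeau_algebra \<and> (\<forall>u\<in>U. colombeau_rel `` {moment_family M p u} = V)"
  proof (rule ex1I[of _ ?V])
    show "?V \<in> colombeau_algebra \<and> (\<forall>u\<in>U. colombeau_rel `` {moment_family M p u} = ?V)"
      by (intro conjI ballI V_mem V)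
    show "V = ?V" if "V \<in> colombeau_algebra \<and> (\<forall>u\<in>U. colombeau_rel `` {moment_family M p u} = V)" for V
      by (rule that[THEN conjunct2, rule_format, OF \<open>w \<in> U\<close>, symmetric])
  qed
  moreover have "\<forall>u\<in>U. (\<forall>\<epsilon>\<in>{0<..1}. \<forall>x. integrable M (\<lambda>\<omega>. u \<epsilon> x \<omega> ^ p)) \<and>
      (\<forall>\<epsilon>\<in>{0<..1}. smooth (moment_family M p u \<epsilon>)) \<and> moment_family M p u \<in> E_M"
    by (intro ballI allI conjI E(1,2) U_sub smooth)
  ultimately show ?thesis
    by (rule conjI[rotated])
qed

end
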